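(* Let $M$ be an MV-effect algebra. Let $G(M)$ be the set of all $\phi_M$-preserving automorphisms of the Boolean algebra $B(M)$. Then $(B(M),G(M))$ is an MV-pair and the MV-effect algebra $\mathcal{A}(B(M),G(M))=B(M)/\sim_{G(M)}$ is isomorphic (as an effect algebra) to $M$.
   Context: **Effect algebras.** An effect algebra is a partial algebra $(E;\oplus,0,1)$ with a binary partial operation $\oplus$ and constants $0,1$ such that: (E1) if $a\oplus b$ is defined, then $b\oplus a$ is defined and $a\oplus b=b\oplus a$; (E2) if $a\oplus b$ and $(a\oplus b)\oplus c$ are defined, then $b\oplus c$ and $a\oplus(b\oplus c)$ are defined and $(a\oplus b)\oplus c=a\oplus(b\oplus c)$; (E3) for every $a$ there is a unique $a'$ with $a\oplus a'=1$; (E4) if $a\oplus 1$ is defined, then $a=0$. One writes $a\le b$ iff there is $c$ with $a\oplus c=b$; this is a partial order with least element $0$ and greatest element $1$, and the element $c$ is unique and denoted $b\ominus a$. Write $a\perp b$ iff $a\oplus b$ is defined. **Morphisms.** A morphism of effect algebras $\phi:E_1\to E_2$ is a map with $\phi(1)=1$ such that whenever $a\oplus b$ exists, $\phi(a)\oplus\phi(b)$ exists and equals $\phi(a\oplus b)$. It is full iff whenever $\phi(a)\perp\phi(b)$ and $\phi(a)\oplus\phi(b)\in\phi(E_1)$, there are $a_1,b_1\in E_1$ with $\phi(a)=\phi(a_1)$, $\phi(b)=\phi(b_1)$ and $a_1\perp b_1$. An isomorphism is a bijective full morphism. **MV-effect algebras.** An MV-effect algebra is an effect algebra $M$ which is a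 lattice in the order $\le$ and satisfies $(a\lor b)\ominus a=b\ominus(a\land b)$ for all $a,b\in M$. As a lattice, $M$ is a bounded distributive lattice. **Boolean algebras as effect algebras; quotients.** A Boolean algebra $B$ is an effect algebra with $a\oplus b$ defined iff $a\wedge b=0$, in which case $a\oplus b=a\vee b$. For an equivalence $\sim$ on an effect algebra $E$, on $E/\sim$ the sum $[a]\oplus[b]$ is defined iff there are $a_1\sim a$, $b_1\sim b$ such that $a_1\oplus b_1$ is defined, and then $[a]\oplus[b]=[a_1\oplus b_1]$; the constants are $[0],[1]$. **MV-pairs.** Let $B$ be a Boolean algebra and $G$ a subgroup of its automorphism group $\mathrm{Aut}(B)$. For $a,b\in B$ write $a\sim_G b$ iff $b=f(a)$ for some $f\in G$, and let $L(a,b)=\{a\wedge f(b):f\in G\}$. For a poset $P$, $\mathrm{max}(P)$ is the set of maximal elements of $P$. The pair $(B,G)$ is an MV-pair iff: (MVP1) for all $a,b\in B$ and $f\in G$ such that $a\le b$ and $f(a)\le b$, there is $h\in G$ such that $h(a)=f(a)$ and $h(b)=b$; (MVP2) for all $a,b\in B$ and $x\in L(a,b)$, there exists $m\in\mathrm{max}(L(a,b))$ with $m\ge x$. For an MV-pair $(B,G)$, the quotient $B/\sim_G$ is an MV-effect algebra, denoted $\mathcal{A}(B,G)$. **R-generated Boolean algebra and $\phi_M$.** For a bounded distributive lattice $D$, $B(D)$ denotes the (unique up to isomorphism) Boolean algebra such that $D$ is a $0,1$-sublattice of $B(D)$ and $D$ generates $B(D)$ as a Boolean algebra. Every $x\in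 B(D)$ has a $D$-chain representation of even length: a finite chain $x_1\le\dots\le x_{2n}$ in $D$ with $x=x_1+\dots+x_{2n}$, where $+$ is symmetric difference. For an MV-effect algebra $M$, $B(M)$ is the Boolean algebra R-generated by the lattice $M$ in this sense, and $\phi_M:B(M)\to M$ is given by $\phi_M(x)=\bigoplus_{i=1}^n(x_{2i}\ominus x_{2i-1})$, where $\{x_i\}_{i=1}^{2n}$ is any $M$-chain representation of $x$ and $\oplus,\ominus$ are taken in $M$. It is known that the value does not depend on the representation and that $\phi_M$ is a surjective morphism of effect algebras. **$\phi_M$-preserving.** For $S\subseteq B(M)$, a map $f:S\to B(M)$ is $\phi_M$-preserving iff $\phi_M(f(x))=\phi_M(x)$ for all $x\in S$. *)

theory Defs
  imports "HOL-Algebra.Group"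
begin

(* HOL-Algebra reuses these names; below sup, inf, top, bot are those of the Boolean type class. *)
hide_const (open) Lattice.sup Lattice.inf Order.top Order.bottom

section \<open>Effect algebras\<close>

text \<open>The partial operation is option-valued: \<^verbatim>\<open>oplus E a b = Some c\<close> says that the sum of
  \<^verbatim>\<open>a\<close> and \<^verbatim>\<open>b\<close> is defined and equals \<^verbatim>\<open>c\<close>. Its values outside the carrier are irrelevant.\<close>

record 'a eff_alg = "'a partial_object" +
  oplus :: "'a \<Rightarrow> 'a \<Rightarrow> 'a option"
  ezero :: 'a
  eone :: 'a

definition eff_orth :: "'a eff_alg \<Rightarrow> 'a \<Rightarrow> 'a \<Rightarrow> bool" where
  "eff_orth E a b \<longleftrightarrow> oplus E a b \<noteq> None"

locale effect_algebra =
  fixes E :: "'a eff_alg"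
  assumes ezero_closed: "ezero E \<in> carrier E"
    and eone_closed: "eone E \<in> carrier E"
    and oplus_closed:
      "\<lbrakk> a \<in> carrier E; b \<in> carrier E; oplus E a b = Some c \<rbrakk> \<Longrightarrow> c \<in> carrier E"
    and E1: "\<lbrakk> a \<in> carrier E; b \<in> carrier E; oplus E a b = Some c \<rbrakk> \<Longrightarrow> oplus E b a = Some c"
    and E2: "\<lbrakk> a \<in> carrier E; b \<in> carrier E; c \<in> carrier E;
        oplus E a b = Some s; oplus E s c = Some t \<rbrakk>
      \<Longrightarrow> \<exists>u. oplus E b c = Some u \<and> oplus E a u = Some t"
    and E3: "a \<in> carrier E \<Longrightarrow> \<exists>!a'. a' \<in> carrier E \<and> oplus E a a' = Some (eone E)"
    and E4: "\<lbrakk> a \<in> carrier E; eff_orth E a (eone E) \<rbrakk> \<Longrightarrow> a = ezero E"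

definition eff_le :: "'a eff_alg \<Rightarrow> 'a \<Rightarrow> 'a \<Rightarrow> bool" where
  "eff_le E a b \<longleftrightarrow> (\<exists>c\<in>carrier E. oplus E a c = Some b)"

definition eff_order :: "'a eff_alg \<Rightarrow> 'a gorder" where
  "eff_order E = \<lparr> carrier = carrier E, eq = (=), le = eff_le E \<rparr>"

text \<open>\<^verbatim>\<open>ominus E b a\<close> is the difference of \<^verbatim>\<open>b\<close> and \<^verbatim>\<open>a\<close>; it is meaningful for \<^verbatim>\<open>a \<le> b\<close> only.\<close>

definition ominus :: "'a eff_alg \<Rightarrow> 'a \<Rightarrow> 'a \<Rightarrow> 'a" where
  "ominus E b a = (THE c. c \<in> carrier E \<and> oplus E a c = Some b)"

fun oplus_list :: "'a eff_alg \<Rightarrow> 'a list \<Rightarrow> 'a option" where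
  "oplus_list E [] = Some (ezero E)"
| "oplus_list E (x # xs) = Option.bind (oplus_list E xs) (oplus E x)"

definition eff_morphism :: "'a eff_alg \<Rightarrow> 'b eff_alg \<Rightarrow> ('a \<Rightarrow> 'b) \<Rightarrow> bool" where
  "eff_morphism E1 E2 \<phi> \<longleftrightarrow>
     effect_algebra E1 \<and> effect_algebra E2 \<and>
     \<phi> \<in> carrier E1 \<rightarrow> carrier E2 \<and>
     \<phi> (eone E1) = eone E2 \<and>
     (\<forall>a\<in>carrier E1. \<forall>b\<in>carrier E1. \<forall>c.
        oplus E1 a b = Some c \<longrightarrow> oplus E2 (\<phi> a) (\<phi> b) = Some (\<phi> c))"

definition full_morphism :: "'a eff_alg \<Rightarrow> 'b eff_alg \<Rightarrow> ('a \<Rightarrow> 'b) \<Rightarrow> bool" where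
  "full_morphism E1 E2 \<phi> \<longleftrightarrow>
     eff_morphism E1 E2 \<phi> \<and>
     (\<forall>a\<in>carrier E1. \<forall>b\<in>carrier E1. \<forall>s\<in>\<phi> ` carrier E1.
        oplus E2 (\<phi> a) (\<phi> b) = Some s \<longrightarrow>
        (\<exists>a1\<in>carrier E1. \<exists>b1\<in>carrier E1. \<phi> a = \<phi> a1 \<and> \<phi> b = \<phi> b1 \<and> eff_orth E1 a1 b1))"

definition eff_iso :: "'a eff_alg \<Rightarrow> 'b eff_alg \<Rightarrow> ('a \<Rightarrow> 'b) \<Rightarrow> bool" where
  "eff_iso E1 E2 \<phi> \<longleftrightarrow> full_morphism E1 E2 \<phi> \<and> bij_betw \<phi> (carrier E1) (carrier E2)"

definition eff_isomorphic :: "'a eff_alg \<Rightarrow> 'b eff_alg \<Rightarrow> bool" where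
  "eff_isomorphic E1 E2 \<longleftrightarrow> (\<exists>\<phi>. eff_iso E1 E2 \<phi>)"

text \<open>\<^verbatim>\<open>r\<close> is an equivalence relation on the carrier. For a general \<^verbatim>\<open>r\<close> the class of the sum may
  depend on the representatives, in which case the value of \<^verbatim>\<open>THE\<close> is unspecified.\<close>

definition eff_quotient :: "'a eff_alg \<Rightarrow> ('a \<times> 'a) set \<Rightarrow> 'a set eff_alg" where
  "eff_quotient E r = \<lparr>
     carrier = carrier E // r,
     oplus = (\<lambda>X Y.
       if \<exists>a\<in>X. \<exists>b\<in>Y. eff_orth E a b
       then Some (THE Z. \<exists>a\<in>X. \<exists>b\<in>Y. \<exists>c. oplus E a b = Some c \<and> Z = r `` {c})
       else None),
     ezero = r `` {ezero E},
     eone = r `` {eone E} \<rparr>"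

locale mv_effect_algebra = effect_algebra M for M :: "'a eff_alg" +
  assumes eff_lattice: "lattice (eff_order M)"
    and mv: "\<lbrakk> a \<in> carrier M; b \<in> carrier M \<rbrakk>
      \<Longrightarrow> ominus M (a \<squnion>\<^bsub>eff_order M\<^esub> b) a = ominus M b (a \<sqinter>\<^bsub>eff_order M\<^esub> b)"


section \<open>Boolean algebras, their automorphisms, and MV-pairs\<close>

definition boolean_eff_alg :: "'b::boolean_algebra eff_alg" where
  "boolean_eff_alg = \<lparr>
     carrier = UNIV,
     oplus = (\<lambda>a b. if inf a b = bot then Some (sup a b) else None),
     ezero = bot,
     eone = top \<rparr>"

definition boolean_aut :: "('b::boolean_algebra \<Rightarrow> 'b) set" where
  "boolean_aut = {f. bij f \<and> (\<forall>x y. f (inf x y) = inf (f x) (f y)) \<and>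
     (\<forall>x y. f (sup x y) = sup (f x) (f y)) \<and> (\<forall>x. f (- x) = - f x)}"

definition Aut :: "('b::boolean_algebra \<Rightarrow> 'b) monoid" where
  "Aut = \<lparr> carrier = boolean_aut, mult = (\<circ>), one = id \<rparr>"

definition orbit_rel :: "('b \<Rightarrow> 'b) set \<Rightarrow> ('b \<times> 'b) set" where
  "orbit_rel G = {(a, b). \<exists>f\<in>G. b = f a}"

definition L_set :: "('b::boolean_algebra \<Rightarrow> 'b) set \<Rightarrow> 'b \<Rightarrow> 'b \<Rightarrow> 'b set" where
  "L_set G a b = {inf a (f b) | f. f \<in> G}"

definition maximal_elements :: "'b::order set \<Rightarrow> 'b set" where
  "maximal_elements P = {m \<in> P. \<forall>y\<in>P. m \<le> y \<longrightarrow> y = m}"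

text \<open>The Boolean algebra of an MV-pair is the whole type \<^verbatim>\<open>'b\<close>.\<close>

definition mv_pair :: "('b::boolean_algebra \<Rightarrow> 'b) set \<Rightarrow> bool" where
  "mv_pair G \<longleftrightarrow>
     subgroup G Aut \<and>
     (\<forall>a b. \<forall>f\<in>G. a \<le> b \<and> f a \<le> b \<longrightarrow> (\<exists>h\<in>G. h a = f a \<and> h b = b)) \<and>
     (\<forall>a b. \<forall>x\<in>L_set G a b. \<exists>m\<in>maximal_elements (L_set G a b). x \<le> m)"

definition mv_pair_algebra :: "('b::boolean_algebra \<Rightarrow> 'b) set \<Rightarrow> 'b set eff_alg" where
  "mv_pair_algebra G = eff_quotient boolean_eff_alg (orbit_rel G)"


section \<open>R-generated Boolean algebras and the map phi\<close>

inductive_set boolean_generated :: "'b::boolean_algebra set \<Rightarrow> 'b set" for S where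
  base: "x \<in> S \<Longrightarrow> x \<in> boolean_generated S"
| bot: "bot \<in> boolean_generated S"
| compl: "x \<in> boolean_generated S \<Longrightarrow> - x \<in> boolean_generated S"
| inf: "\<lbrakk> x \<in> boolean_generated S; y \<in> boolean_generated S \<rbrakk> \<Longrightarrow> inf x y \<in> boolean_generated S"
| sup: "\<lbrakk> x \<in> boolean_generated S; y \<in> boolean_generated S \<rbrakk> \<Longrightarrow> sup x y \<in> boolean_generated S"

text \<open>The Boolean algebra \<^verbatim>\<open>'b\<close> together with the embedding \<open>\<iota>\<close> of the bounded lattice \<^verbatim>\<open>D\<close> is an
  R-generated Boolean algebra \<^verbatim>\<open>B(D)\<close>: \<open>\<iota>\<close> identifies \<^verbatim>\<open>D\<close> with a 0,1-sublattice generating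
  \<^verbatim>\<open>'b\<close>. As \<^verbatim>\<open>B(D)\<close> is determined up to isomorphism only, we do not fix a construction of it.\<close>

definition R_generated :: "'a gorder \<Rightarrow> ('a \<Rightarrow> 'b::boolean_algebra) \<Rightarrow> bool" where
  "R_generated D \<iota> \<longleftrightarrow>
     inj_on \<iota> (carrier D) \<and>
     \<iota> \<bottom>\<^bsub>D\<^esub> = bot \<and> \<iota> \<top>\<^bsub>D\<^esub> = top \<and>
     (\<forall>x\<in>carrier D. \<forall>y\<in>carrier D.
        \<iota> (x \<squnion>\<^bsub>D\<^esub> y) = sup (\<iota> x) (\<iota> y) \<and> \<iota> (x \<sqinter>\<^bsub>D\<^esub> y) = inf (\<iota> x) (\<iota> y)) \<and>
     boolean_generated (\<iota> ` carrier D) = UNIV"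

definition bsymdiff :: "'b::boolean_algebra \<Rightarrow> 'b \<Rightarrow> 'b" where
  "bsymdiff x y = sup (x - y) (y - x)"

text \<open>\<^verbatim>\<open>xs\<close> lists \<open>x\<^sub>1 \<le> \<dots> \<le> x\<^sub>2\<^sub>n\<close>. The empty chain is admitted; it represents \<^verbatim>\<open>bot\<close>, as does
  the chain \<open>0 \<le> 0\<close>, and it gives the same value of phi.\<close>

definition chain_rep :: "'a gorder \<Rightarrow> ('a \<Rightarrow> 'b::boolean_algebra) \<Rightarrow> 'b \<Rightarrow> 'a list \<Rightarrow> bool" where
  "chain_rep D \<iota> x xs \<longleftrightarrow>
     set xs \<subseteq> carrier D \<and> sorted_wrt (le D) xs \<and> even (length xs) \<and>
     x = foldr bsymdiff (map \<iota> xs) bot"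

text \<open>List positions start at 0, so the \<^verbatim>\<open>i\<close>-th summand is the difference of the entries at
  \<^verbatim>\<open>2 * i + 1\<close> and \<^verbatim>\<open>2 * i\<close>. The description \<^verbatim>\<open>THE\<close> is justified since the value does not depend
  on the representation.\<close>

definition chain_diffs :: "'a eff_alg \<Rightarrow> 'a list \<Rightarrow> 'a list" where
  "chain_diffs M xs = map (\<lambda>i. ominus M (xs ! (2 * i + 1)) (xs ! (2 * i))) [0..<length xs div 2]"

definition phi_M :: "'a eff_alg \<Rightarrow> ('a \<Rightarrow> 'b::boolean_algebra) \<Rightarrow> 'b \<Rightarrow> 'a" where
  "phi_M M \<iota> x =
     (THE y. \<exists>xs. chain_rep (eff_order M) \<iota> x xs \<and> oplus_list M (chain_diffs M xs) = Some y)"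

definition phi_preserving ::
    "'a eff_alg \<Rightarrow> ('a \<Rightarrow> 'b::boolean_algebra) \<Rightarrow> 'b set \<Rightarrow> ('b \<Rightarrow> 'b) \<Rightarrow> bool" where
  "phi_preserving M \<iota> S f \<longleftrightarrow> (\<forall>x\<in>S. phi_M M \<iota> (f x) = phi_M M \<iota> x)"

definition G_M :: "'a eff_alg \<Rightarrow> ('a \<Rightarrow> 'b::boolean_algebra) \<Rightarrow> ('b \<Rightarrow> 'b) set" where
  "G_M M \<iota> = {f \<in> boolean_aut. phi_preserving M \<iota> UNIV f}"

end

theory Submission
  imports Defs
begin

text \<open>A chain \<open>0 = c\<^sub>0 \<le> \<dots> \<le> c\<^sub>n = 1\<close> in \<open>M\<close> cuts \<open>B(M)\<close> into cells \<open>c\<^sub>i\<^sub>+\<^sub>1 - c\<^sub>i\<close>, and every \<open>b\<close>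
  in \<open>B(M)\<close> is a union of cells of a suitable chain; \<open>\<phi>\<^sub>M(b)\<close> is the sum of the differences
  \<open>c\<^sub>i\<^sub>+\<^sub>1 \<ominus> c\<^sub>i\<close> over the cells below \<open>b\<close>. Two chains refine each other to pieces with the same
  differences, so the value does not depend on the chain, and a common chain for \<open>a\<close> and \<open>b\<close>
  shows that \<open>\<phi>\<^sub>M\<close> is additive.

  If \<open>y \<ominus> x = y' \<ominus> x'\<close>, the translation \<open>t \<mapsto> x' \<oplus> (t \<ominus> x)\<close> is a lattice isomorphism from \<open>[x, y]\<close> to
  \<open>[x', y']\<close>; applied to chains it gives a \<open>\<phi>\<^sub>M\<close>-preserving isomorphism of the Boolean algebras
  below \<open>y - x\<close> and \<open>y' - x'\<close>. Stacking the cells of \<open>b\<close> on top of each other, the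
  algebra below \<open>b\<close> becomes \<open>\<phi>\<^sub>M\<close>-isomorphic to the one below \<open>\<phi>\<^sub>M(b)\<close>. Hence elements with
  equal \<open>\<phi>\<^sub>M\<close> have \<open>\<phi>\<^sub>M\<close>-isomorphic ideals, and gluing such isomorphisms over a partition of
  unity yields automorphisms: the orbits of \<open>G(M)\<close> are the fibres of \<open>\<phi>\<^sub>M\<close>. Both MV-pair
  conditions then reduce to arithmetic in \<open>M\<close>, and the quotient is \<open>M\<close> itself.\<close>

section \<open>Effect algebras\<close>

context effect_algebra
begin

section \<open>Cancellation, order and differences\<close>

lemma oplus_commute:
  assumes "a \<in> carrier E" "b \<in> carrier E"
  shows "oplus E a b = oplus E b a"
proof (cases "oplus E a b")
  case None
  then show ?thesis using E1[OF assms(2,1)] by (cases "oplus E b a") auto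
next
  case (Some c)
  then show ?thesis using E1[OF assms] by auto
qed

text \<open>E4 forces the complement of 1 to be 0, so \<open>a' \<oplus> a = 1\<close> extends by 0.
  Reassociated, this makes \<open>a \<oplus> 0\<close> a complement of \<open>a'\<close>, as
  \<open>a\<close> is, and E3 allows only one.\<close>

lemma oplus_zero_right:
  assumes a: "a \<in> carrier E"
  shows "oplus E a (ezero E) = Some a"
proof -
  obtain z where z: "z \<in> carrier E" "oplus E (eone E) z = Some (eone E)"
    using E3[OF eone_closed] by blast
  have "oplus E z (eone E) = Some (eone E)" using E1[OF eone_closed z] .
  then have "z = ezero E" using E4[OF z(1)] by (auto simp: eff_orth_def)
  with z have one: "oplus E (eone E) (ezero E) = Some (eone E)" by simp
  obtain a' where a': "a' \<in> carrier E" "oplus E a a' = Some (eone E)" using E3[OF a] by blast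
  have a'a: "oplus E a' a = Some (eone E)" using E1[OF a a'] .
  obtain u where u: "oplus E a (ezero E) = Some u" "oplus E a' u = Some (eone E)"
    using E2[OF a'(1) a ezero_closed a'a one] by blast
  have "u = a"
    using E3[OF a'(1)] a'a u oplus_closed[OF a ezero_closed u(1)] a by blast
  with u show ?thesis by simp
qed

lemma oplus_zero_left: "a \<in> carrier E \<Longrightarrow> oplus E (ezero E) a = Some a"
  using oplus_zero_right oplus_commute ezero_closed by metis

text \<open>If \<open>a \<oplus> b = 0\<close>, then \<open>(a \<oplus> b) \<oplus> 1\<close> is
  defined; E2 then defines \<open>b \<oplus> 1\<close>, and E4 applies.\<close>

lemma oplus_eq_zeroD:
  assumes "a \<in> carrier E" "b \<in> carrier E" "oplus E a b = Some (ezero E)"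
  shows "a = ezero E" "b = ezero E"
proof -
  have *: "b = ezero E" if "a \<in> carrier E" "b \<in> carrier E" "oplus E a b = Some (ezero E)" for a b
    using E2[OF that(1,2) eone_closed that(3) oplus_zero_left[OF eone_closed]] E4[OF that(2)]
    by (auto simp: eff_orth_def)
  show "b = ezero E" using * assms by blast
  show "a = ezero E" using * assms E1 by blast
qed

text \<open>With \<open>s'\<close> the complement of \<open>s\<close>, both \<open>b\<close> and
  \<open>c\<close> are complements of \<open>a \<oplus> s'\<close>.\<close>

lemma oplus_left_cancel:
  assumes a: "a \<in> carrier E" and b: "b \<in> carrier E" and c: "c \<in> carrier E"
    and ab: "oplus E a b = Some s" and ac: "oplus E a c = Some s"
  shows "b = c"
proof -
  have s: "s \<in> carrier E" using oplus_closed[OF a b ab] .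
  obtain s' where s': "s' \<in> carrier E" "oplus E s s' = Some (eone E)" using E3[OF s] by blast
  obtain u where u: "oplus E a s' = Some u" "oplus E b u = Some (eone E)"
    using E2[OF b a s'(1) E1[OF a b ab] s'(2)] by blast
  have uc: "u \<in> carrier E" using oplus_closed[OF a s'(1) u(1)] .
  have "oplus E c u = Some (eone E)"
    using E2[OF c a s'(1) E1[OF a c ac] s'(2)] u(1) by auto
  then show ?thesis using E3[OF uc] E1[OF b uc u(2)] E1[OF c uc] b c by blast
qed

text \<open>E2 gives one direction; the other is E2 for the reversed triple, read through
  commutativity. Comparing \<open>Option.bind\<close> terms covers undefined sums as well.\<close>

lemma oplus_assoc_iff:
  assumes a: "a \<in> carrier E" and b: "b \<in> carrier E" and c: "c \<in> carrier E"
  shows "Option.bind (oplus E a b) (\<lambda>s. oplus E s c) = Option.bind (oplus E b c) (oplus E a)"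
proof -
  have 1: "Option.bind (oplus E y z) (oplus E x) = Some t"
    if xyz: "x \<in> carrier E" "y \<in> carrier E" "z \<in> carrier E"
      and xyzt: "Option.bind (oplus E x y) (\<lambda>s. oplus E s z) = Some t" for x y z t
  proof -
    obtain s where "oplus E x y = Some s" "oplus E s z = Some t"
      using xyzt by (auto simp: bind_eq_Some_conv)
    then show ?thesis using E2[OF xyz] by (auto simp: bind_eq_Some_conv)
  qed
  have 2: "Option.bind (oplus E y z) (oplus E x) = Option.bind (oplus E z y) (\<lambda>s. oplus E s x)"
    if "x \<in> carrier E" "y \<in> carrier E" "z \<in> carrier E" for x y z
    using oplus_commute[OF that(2,3)] oplus_commute[OF that(1) oplus_closed[OF that(3,2)]]
    by (cases "oplus E z y") auto
  let ?l = "Option.bind (oplus E a b) (\<lambda>s. oplus E s c)"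
  let ?r = "Option.bind (oplus E b c) (oplus E a)"
  have lr: "?r = Some t" if "?l = Some t" for t using 1[OF a b c that] .
  have rl: "?l = Some t" if "?r = Some t" for t
    using 1[OF c b a] that 2[OF a b c] 2[OF c b a] by simp
  show ?thesis
  proof (cases ?l)
    case None
    then show ?thesis using rl by (cases ?r) simp_all
  qed (use lr in simp)
qed

lemma eff_le_refl: "a \<in> carrier E \<Longrightarrow> eff_le E a a"
  using oplus_zero_right ezero_closed by (auto simp: eff_le_def)

lemma eff_le_trans:
  assumes "a \<in> carrier E" "eff_le E a b" "eff_le E b c"
  shows "eff_le E a c"
proof -
  obtain x y where x: "x \<in> carrier E" "oplus E a x = Some b" and y: "y \<in> carrier E" "oplus E b y = Some c"
    using assms by (auto simp: eff_le_def)
  from E2[OF assms(1) x(1) y(1) x(2) y(2)] show ?thesis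
    using oplus_closed[OF x(1) y(1)] by (auto simp: eff_le_def)
qed

lemma eff_le_antisym:
  assumes a: "a \<in> carrier E" and "eff_le E a b" "eff_le E b a"
  shows "a = b"
proof -
  obtain c d where c: "c \<in> carrier E" "oplus E a c = Some b"
    and d: "d \<in> carrier E" "oplus E b d = Some a"
    using assms by (auto simp: eff_le_def)
  obtain u where u: "oplus E c d = Some u" "oplus E a u = Some a" using E2[OF a c(1) d(1) c(2) d(2)] by blast
  have uc: "u \<in> carrier E" using oplus_closed c d u by blast
  have "u = ezero E" using oplus_left_cancel[OF a uc ezero_closed u(2) oplus_zero_right[OF a]] .
  then have "c = ezero E" using oplus_eq_zeroD c d u by blast
  then show ?thesis using c oplus_zero_right a by simp
qed

lemma eff_le_zero: "a \<in> carrier E \<Longrightarrow> eff_le E (ezero E) a"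
  using oplus_zero_left by (auto simp: eff_le_def)

lemma eff_le_one: "a \<in> carrier E \<Longrightarrow> eff_le E a (eone E)"
  using E3 unfolding eff_le_def by blast

lemma eff_le_closed: "a \<in> carrier E \<Longrightarrow> eff_le E a b \<Longrightarrow> b \<in> carrier E"
  unfolding eff_le_def using oplus_closed by blast

lemma oplus_ominus:
  assumes "a \<in> carrier E" "eff_le E a b"
  shows "ominus E b a \<in> carrier E" "oplus E a (ominus E b a) = Some b"
proof -
  have "\<exists>!c. c \<in> carrier E \<and> oplus E a c = Some b"
    using assms oplus_left_cancel unfolding eff_le_def by blast
  from theI'[OF this] show "ominus E b a \<in> carrier E" "oplus E a (ominus E b a) = Some b"
    by (auto simp: ominus_def)
qed

lemma ominus_eqI:
  assumes "a \<in> carrier E" "c \<in> carrier E" "oplus E a c = Some b"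
  shows "ominus E b a = c"
proof -
  have "eff_le E a b" using assms by (auto simp: eff_le_def)
  from oplus_ominus[OF assms(1) this] show ?thesis
    using oplus_left_cancel[OF assms(1) _ assms(2) _ assms(3)] by blast
qed

lemma ominus_self: "a \<in> carrier E \<Longrightarrow> ominus E a a = ezero E"
  using ominus_eqI oplus_zero_right ezero_closed by blast

lemma ominus_zero: "a \<in> carrier E \<Longrightarrow> ominus E a (ezero E) = a"
  using ominus_eqI oplus_zero_left ezero_closed by blast

lemma oplus_mono:
  assumes "s \<in> carrier E" "d \<in> carrier E" "eff_le E s t" "oplus E t d = Some w"
  shows "\<exists>r. oplus E s d = Some r \<and> eff_le E r w"
proof -
  obtain e where e: "e \<in> carrier E" "oplus E s e = Some t" using assms by (auto simp: eff_le_def)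
  have "oplus E e s = Some t" using E1 assms e by blast
  then obtain u where "oplus E s d = Some u" "oplus E e u = Some w"
    using E2[OF e(1) assms(1,2) _ assms(4)] by blast
  then show ?thesis using E1[OF e(1)] oplus_closed[OF assms(1,2)] e unfolding eff_le_def by blast
qed

lemma ominus_oplus_ominus:
  assumes "a \<in> carrier E" "eff_le E a b" "eff_le E b c"
  shows "oplus E (ominus E b a) (ominus E c b) = Some (ominus E c a)"
proof -
  have b: "b \<in> carrier E" using eff_le_closed assms by blast
  note 1 = oplus_ominus[OF assms(1,2)] and 2 = oplus_ominus[OF b assms(3)]
  obtain u where u: "oplus E (ominus E b a) (ominus E c b) = Some u" "oplus E a u = Some c"
    using E2[OF assms(1) 1(1) 2(1) 1(2) 2(2)] by blast
  then show ?thesis using ominus_eqI[OF assms(1) oplus_closed[OF 1(1) 2(1) u(1)] u(2)] by simp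
qed

text \<open>The partial sum becomes a commutative monoid operation on the whole option type, with
  \<open>None\<close> for an undefined sum. Elements outside the carrier have no sum with anything but zero;
  associativity then depends on a sum being zero only if both summands are.\<close>

definition opt_plus :: "'a option \<Rightarrow> 'a option \<Rightarrow> 'a option" where
  "opt_plus x y =
     (if x = Some (ezero E) then y else if y = Some (ezero E) then x
      else Option.bind x (\<lambda>a. Option.bind y (\<lambda>b.
        if a \<in> carrier E \<and> b \<in> carrier E then oplus E a b else None)))"

lemma opt_plus_Some:
  "a \<in> carrier E \<Longrightarrow> b \<in> carrier E \<Longrightarrow> opt_plus (Some a) (Some b) = oplus E a b"
  by (simp add: opt_plus_def oplus_zero_left oplus_zero_right)

lemma opt_plus_zero_iff:
  "opt_plus x y = Some (ezero E) \<longleftrightarrow> x = Some (ezero E) \<and> y = Some (ezero E)"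
proof
  assume *: "opt_plus x y = Some (ezero E)"
  show "x = Some (ezero E) \<and> y = Some (ezero E)"
  proof (rule ccontr)
    assume "\<not> ?thesis"
    then have ne: "x \<noteq> Some (ezero E)" "y \<noteq> Some (ezero E)" using * by (auto simp: opt_plus_def)
    then obtain a b where "x = Some a" "y = Some b" "a \<in> carrier E" "b \<in> carrier E"
      "oplus E a b = Some (ezero E)"
      using * by (auto simp: opt_plus_def bind_eq_Some_conv split: if_splits)
    then show False using ne oplus_eq_zeroD by blast
  qed
qed (simp add: opt_plus_def)

lemma opt_plus_commute: "opt_plus x y = opt_plus y x"
  by (cases x; cases y) (simp_all add: opt_plus_def oplus_commute)

lemma opt_plus_None [simp]: "opt_plus None y = None" "opt_plus y None = None"
  by (auto simp: opt_plus_def)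

lemma opt_plus_outside:
  "a \<notin> carrier E \<Longrightarrow> y \<noteq> Some (ezero E) \<Longrightarrow> opt_plus (Some a) y = None"
  using ezero_closed by (cases y) (auto simp: opt_plus_def)

lemma opt_plus_assoc: "opt_plus (opt_plus x y) z = opt_plus x (opt_plus y z)"
proof (cases "x = Some (ezero E) \<or> y = Some (ezero E) \<or> z = Some (ezero E)")
  case True
  then show ?thesis by (auto simp: opt_plus_def)
next
  case nz: False
  have absorb: "opt_plus w v = None" if "w \<notin> Some ` carrier E" "v \<noteq> Some (ezero E)" for w v
    using that opt_plus_None opt_plus_outside by (cases w) auto
  consider (x) "x \<notin> Some ` carrier E" | (y) "y \<notin> Some ` carrier E" | (z) "z \<notin> Some ` carrier E"
    | (all) "x \<in> Some ` carrier E" "y \<in> Some ` carrier E" "z \<in> Some ` carrier E" by blast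
  then show ?thesis
  proof cases
    case x
    have "opt_plus x y = None" "opt_plus x (opt_plus y z) = None"
      using absorb[OF x] nz opt_plus_zero_iff by blast+
    then show ?thesis by simp
  next
    case y
    have "opt_plus y x = None" "opt_plus y z = None" using absorb[OF y] nz by blast+
    then show ?thesis by (simp add: opt_plus_commute[of x y])
  next
    case z
    have "opt_plus z y = None" "opt_plus z (opt_plus x y) = None"
      using absorb[OF z] nz opt_plus_zero_iff by blast+
    then show ?thesis by (simp add: opt_plus_commute[of _ z])
  next
    case all
    then obtain a b c where abc: "x = Some a" "y = Some b" "z = Some c"
      "a \<in> carrier E" "b \<in> carrier E" "c \<in> carrier E" by blast
    have "opt_plus (opt_plus x y) z = Option.bind (oplus E a b) (\<lambda>s. oplus E s c)"
      using abc nz oplus_closed[of a b]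
      by (cases "oplus E a b") (auto simp: opt_plus_Some)
    moreover have "opt_plus x (opt_plus y z) = Option.bind (oplus E b c) (oplus E a)"
      using abc nz oplus_closed[of b c]
      by (cases "oplus E b c") (auto simp: opt_plus_Some)
    ultimately show ?thesis using oplus_assoc_iff abc by simp
  qed
qed

sublocale osum: comm_monoid_set opt_plus "Some (ezero E)"
proof
  show "opt_plus x y = opt_plus y x" for x y by (rule opt_plus_commute)
qed (simp_all add: opt_plus_assoc, simp add: opt_plus_def)

text \<open>Turns the recursive sum into one over an index set, where sums can be reindexed and
  exchanged.\<close>

lemma oplus_list_eq_osum:
  assumes "set xs \<subseteq> carrier E"
  shows "oplus_list E xs = osum.F (\<lambda>i. Some (xs ! i)) {..<length xs}"
proof -
  \<comment> \<open>The induction also carries that a defined sum lies in the carrier, since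
    \<open>opt_plus_Some\<close> ties \<open>opt_plus\<close> to \<open>oplus\<close> only
    there.\<close>
  have "oplus_list E xs = osum.F (\<lambda>i. Some (xs ! i)) {..<length xs} \<and>
    (\<forall>s. oplus_list E xs = Some s \<longrightarrow> s \<in> carrier E)"
    using assms
  proof (induction xs)
    case Nil
    then show ?case using ezero_closed by simp
  next
    case (Cons x xs)
    have F: "osum.F (\<lambda>i. Some ((x # xs) ! i)) {..<length (x # xs)}
      = opt_plus (Some x) (osum.F (\<lambda>i. Some (xs ! i)) {..<length xs})"
      by (simp add: osum.lessThan_Suc_shift del: osum.lessThan_Suc)
    show ?case
    proof (cases "oplus_list E xs")
      case None
      then have "osum.F (\<lambda>i. Some (xs ! i)) {..<length xs} = None" using Cons by simp
      then show ?thesis using F None by simp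
    next
      case (Some s)
      then have s: "s \<in> carrier E" "osum.F (\<lambda>i. Some (xs ! i)) {..<length xs} = Some s"
        using Cons by auto
      then show ?thesis
        using F Some Cons.prems oplus_closed[OF _ s(1), of x] by (auto simp: opt_plus_Some)
    qed
  qed
  then show ?thesis by blast
qed

end

section \<open>Chains in the generating lattice\<close>

lemma eff_order_simps [simp]:
  "carrier (eff_order E) = carrier E" "le (eff_order E) = eff_le E" "eq (eff_order E) = (=)"
  by (auto simp: eff_order_def)

definition cell :: "('a \<Rightarrow> 'b::boolean_algebra) \<Rightarrow> (nat \<Rightarrow> 'a) \<Rightarrow> nat \<Rightarrow> 'b" where
  "cell \<iota> c i = \<iota> (c (Suc i)) - \<iota> (c i)"

text \<open>For values in the lattice the right-hand side is an inequality in the lattice, so disjointness of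
  cells is preserved by lattice isomorphisms.\<close>

lemma diff_inf_diff_eq_bot_iff:
  "inf (a - b) (c - d) = bot \<longleftrightarrow> inf a c \<le> sup b (d::'b::boolean_algebra)"
proof -
  have "inf (a - b) (c - d) = inf (inf a c) (- sup b d)"
    by (simp add: diff_eq ac_simps)
  then show ?thesis by (simp add: inf_shunt)
qed

lemma diff_eq_bot_iff: "a - b = bot \<longleftrightarrow> a \<le> (b::'b::boolean_algebra)"
  by (simp add: diff_eq inf_shunt)

locale mv_boolean = mv_effect_algebra M for M :: "'a eff_alg" +
  fixes \<iota> :: "'a \<Rightarrow> 'b::boolean_algebra"
  assumes R_gen: "R_generated (eff_order M) \<iota>"
begin

abbreviation "C \<equiv> carrier M"
abbreviation jn (infixl "\<curlyvee>" 65) where "a \<curlyvee> b \<equiv> a \<squnion>\<^bsub>eff_order M\<^esub> b"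
abbreviation mt (infixl "\<curlywedge>" 70) where "a \<curlywedge> b \<equiv> a \<sqinter>\<^bsub>eff_order M\<^esub> b"
abbreviation ele (infix "\<preceq>" 50) where "a \<preceq> b \<equiv> eff_le M a b"
abbreviation om (infixl "\<ominus>" 65) where "b \<ominus> a \<equiv> ominus M b a"

interpretation L: lattice "eff_order M" by (rule eff_lattice)

section \<open>The lattice \<open>M\<close> inside the Boolean algebra\<close>

lemma join_closed: "a \<in> C \<Longrightarrow> b \<in> C \<Longrightarrow> a \<curlyvee> b \<in> C"
  and meet_closed: "a \<in> C \<Longrightarrow> b \<in> C \<Longrightarrow> a \<curlywedge> b \<in> C"
  using L.join_closed L.meet_closed by auto

lemma bottom_eff_order: "\<bottom>\<^bsub>eff_order M\<^esub> = ezero M"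
proof -
  have "least (eff_order M) (ezero M) C"
    using eff_le_zero ezero_closed by (auto simp: least_def)
  then show ?thesis unfolding bottom_def by (intro some_equality) (auto intro: L.least_unique)
qed

lemma top_eff_order: "\<top>\<^bsub>eff_order M\<^esub> = eone M"
proof -
  have "greatest (eff_order M) (eone M) C"
    using eff_le_one eone_closed by (auto simp: greatest_def)
  then show ?thesis unfolding top_def by (intro some_equality) (auto intro: L.greatest_unique)
qed

lemma iota_zero [simp]: "\<iota> (ezero M) = bot" and iota_one [simp]: "\<iota> (eone M) = top"
  using R_gen by (auto simp: R_generated_def bottom_eff_order top_eff_order)

lemma iota_join: "a \<in> C \<Longrightarrow> b \<in> C \<Longrightarrow> \<iota> (a \<curlyvee> b) = sup (\<iota> a) (\<iota> b)"
  and iota_meet: "a \<in> C \<Longrightarrow> b \<in> C \<Longrightarrow> \<iota> (a \<curlywedge> b) = inf (\<iota> a) (\<iota> b)"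
  using R_gen by (auto simp: R_generated_def)

lemma iota_inj: "a \<in> C \<Longrightarrow> b \<in> C \<Longrightarrow> \<iota> a = \<iota> b \<longleftrightarrow> a = b"
  using R_gen by (auto simp: R_generated_def inj_on_def)

lemma iota_eqI: "a \<in> C \<Longrightarrow> b \<in> C \<Longrightarrow> \<iota> a = \<iota> b \<Longrightarrow> a = b"
  using iota_inj by blast

text \<open>The order is equational, \<open>a = a \<curlywedge> b\<close>, so an injective lattice
  homomorphism also reflects it. Lattice arguments in \<open>M\<close> can thus be carried out in
  the Boolean algebra.\<close>

lemma eff_le_iff_iota:
  assumes "a \<in> C" "b \<in> C"
  shows "a \<preceq> b \<longleftrightarrow> \<iota> a \<le> \<iota> b"
proof -
  have "a \<preceq> b \<longleftrightarrow> a = a \<curlywedge> b" using L.le_iff_join[of a b] assms by simp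
  also have "\<dots> \<longleftrightarrow> \<iota> a = \<iota> (a \<curlywedge> b)" using iota_inj[of a "a \<curlywedge> b"] meet_closed assms by simp
  also have "\<dots> \<longleftrightarrow> \<iota> a \<le> \<iota> b" using iota_meet assms by (metis inf.absorb_iff1)
  finally show ?thesis .
qed

lemma mv_law: "a \<in> C \<Longrightarrow> b \<in> C \<Longrightarrow> (a \<curlyvee> b) \<ominus> a = b \<ominus> (a \<curlywedge> b)"
  using mv .

text \<open>Since \<open>v'\<close> meets \<open>u\<close> only below \<open>v\<close>, the MV law
  moves \<open>u \<ominus> v\<close> up to
  \<open>(u \<curlyvee> v') \<ominus> (v \<curlyvee> v')\<close>; by symmetry
  \<open>u' \<ominus> v'\<close> moves to the same place. So a difference in \<open>M\<close>
  depends only on the cell that it measures, which makes different chains comparable.\<close>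

lemma ominus_eq_of_iota_diff_eq:
  assumes C: "u \<in> C" "v \<in> C" "u' \<in> C" "v' \<in> C" and le: "v \<preceq> u" "v' \<preceq> u'"
    and eq: "\<iota> u - \<iota> v = \<iota> u' - \<iota> v'"
  shows "u \<ominus> v = u' \<ominus> v'"
proof -
  have *: "u \<ominus> v = (u \<curlyvee> v') \<ominus> (v \<curlyvee> v')"
    if C: "u \<in> C" "v \<in> C" "u' \<in> C" "v' \<in> C" and le: "v \<preceq> u" "v' \<preceq> u'"
    and eq: "\<iota> u - \<iota> v = \<iota> u' - \<iota> v'" for u v u' v'
  proof -
    have j: "v \<curlyvee> v' \<in> C" using join_closed C by blast
    have vu: "\<iota> v \<le> \<iota> u" using eff_le_iff_iota le C by simp
    have "inf (\<iota> u - \<iota> v) (\<iota> v') = bot" unfolding eq by (simp add: diff_eq inf_assoc)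
    then have "inf (\<iota> u) (\<iota> v') \<le> \<iota> v"
      by (metis (no_types, lifting) diff_eq inf_commute inf_left_commute inf_shunt double_compl)
    then have "inf (\<iota> u) (sup (\<iota> v) (\<iota> v')) = \<iota> v"
      using vu by (simp add: inf_sup_distrib1 inf.absorb2 sup.absorb1)
    then have "(v \<curlyvee> v') \<curlywedge> u = v"
      using C j by (intro iota_eqI) (simp_all add: iota_join iota_meet meet_closed inf_commute)
    moreover have "(v \<curlyvee> v') \<curlyvee> u = u \<curlyvee> v'"
    proof (rule iota_eqI)
      have "sup (sup (\<iota> v) (\<iota> v')) (\<iota> u) = sup (\<iota> u) (\<iota> v')"
        using vu by (metis sup.absorb1 sup_assoc sup_commute)
      then show "\<iota> ((v \<curlyvee> v') \<curlyvee> u) = \<iota> (u \<curlyvee> v')" using C j by (simp add: iota_join)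
    qed (use C j join_closed in auto)
    ultimately show ?thesis using mv_law[OF j C(1)] by simp
  qed
  have "\<iota> u - \<iota> v \<le> \<iota> u'" "\<iota> u' - \<iota> v' \<le> \<iota> u"
    by (simp add: eq, simp add: diff_eq) (simp add: eq[symmetric], simp add: diff_eq)
  then have "\<iota> u \<le> sup (\<iota> v) (\<iota> u')" "\<iota> u' \<le> sup (\<iota> v') (\<iota> u)"
    by (simp_all add: diff_eq shunt2)
  moreover have "\<iota> v \<le> \<iota> u" "\<iota> v' \<le> \<iota> u'" using eff_le_iff_iota le C by auto
  ultimately have "sup (\<iota> u) (\<iota> v') = sup (\<iota> u') (\<iota> v)"
    by (intro antisym sup_least) (auto intro: le_supI1 le_supI2 order_trans)
  then have "u \<curlyvee> v' = u' \<curlyvee> v"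
    using C by (intro iota_eqI) (simp_all add: iota_join join_closed)
  moreover have "v \<curlyvee> v' = v' \<curlyvee> v" by (rule join_comm)
  ultimately show ?thesis using *[OF C le eq] *[OF C(3,4,1,2) le(2,1) eq[symmetric]] by simp
qed

text \<open>A chain stays constant from index \<open>n\<close> on, so that all its values lie between \<open>x\<close> and \<open>y\<close>.\<close>

definition chain :: "(nat \<Rightarrow> 'a) \<Rightarrow> nat \<Rightarrow> 'a \<Rightarrow> 'a \<Rightarrow> bool" where
  "chain c n x y \<longleftrightarrow> (\<forall>i. c i \<in> C) \<and> (\<forall>i. c i \<preceq> c (Suc i)) \<and> c 0 = x \<and> (\<forall>i\<ge>n. c i = y)"

definition splits :: "(nat \<Rightarrow> 'a) \<Rightarrow> nat \<Rightarrow> 'b \<Rightarrow> bool" where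
  "splits c n b \<longleftrightarrow> (\<forall>i<n. cell \<iota> c i \<le> b \<or> inf (cell \<iota> c i) b = bot)"

lemma chainD:
  assumes "chain c n x y"
  shows "c i \<in> C" "c i \<preceq> c (Suc i)" "c 0 = x" "c n = y" "i \<ge> n \<Longrightarrow> c i = y"
  using assms by (auto simp: chain_def)

lemma chain_mono: "chain c n x y \<Longrightarrow> i \<le> j \<Longrightarrow> c i \<preceq> c j"
proof (induction j)
  case 0
  then show ?case using eff_le_refl chainD(1) by fastforce
next
  case (Suc j)
  then show ?case
    using eff_le_refl eff_le_trans chainD(1,2) by (metis le_Suc_eq)
qed

lemma chain_between:
  assumes "chain c n x y"
  shows "x \<in> C" "y \<in> C" "x \<preceq> c i" "c i \<preceq> y"
  using chain_mono[OF assms, of 0 i] chain_mono[OF assms, of i "max i n"] chainD[OF assms]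
    chainD(5)[OF assms, of "max i n"] chainD(1)[OF assms, of 0] chainD(1)[OF assms, of n] by auto

lemma iota_chain_mono: "chain c n x y \<Longrightarrow> i \<le> j \<Longrightarrow> \<iota> (c i) \<le> \<iota> (c j)"
  using eff_le_iff_iota[OF chainD(1) chainD(1)] chain_mono by blast

lemma iota_Suc_cell:
  "chain c n x y \<Longrightarrow> \<iota> (c (Suc i)) = sup (\<iota> (c i)) (cell \<iota> c i)"
  using iota_chain_mono[of c n x y i "Suc i"]
  by (simp add: cell_def diff_eq sup_inf_distrib1 sup.absorb2)

text \<open>Induction along the chain: \<open>p\<close> is disjoint from
  \<open>\<iota> (c 0)\<close>, and each step adds a single cell. Inclusions can thus be tested cell
  by cell.\<close>

lemma cells_cover:
  assumes c: "chain c n x y" and p: "p \<le> \<iota> y - \<iota> x"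
    and cells: "\<And>i. i < n \<Longrightarrow> inf p (cell \<iota> c i) = bot"
  shows "p = bot"
proof -
  have "inf p (\<iota> (c k)) = bot" if "k \<le> n" for k
    using that
  proof (induction k)
    case 0
    have "p \<le> - \<iota> x" using p by (simp add: diff_eq)
    then show ?case using chainD(3)[OF c] by (simp add: inf_shunt)
  next
    case (Suc k)
    then show ?case using cells[of k] by (simp add: iota_Suc_cell[OF c] inf_sup_distrib1)
  qed
  from this[of n] have "inf p (\<iota> y) = bot" using chainD(4)[OF c] by simp
  moreover have "p \<le> \<iota> y" using p by (simp add: diff_eq)
  ultimately show ?thesis by (simp add: inf.absorb1)
qed

lemma osum_telescope:
  assumes c: "chain c n x y"
  shows "osum.F (\<lambda>i. Some (c (Suc i) \<ominus> c i)) {..<k} = Some (c k \<ominus> c 0)"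
proof (induction k)
  case 0
  then show ?case using ominus_self chainD(1)[OF c] by simp
next
  case (Suc k)
  have "oplus M (c k \<ominus> c 0) (c (Suc k) \<ominus> c k) = Some (c (Suc k) \<ominus> c 0)"
    by (rule ominus_oplus_ominus[OF chainD(1)[OF c] chain_mono[OF c] chain_mono[OF c]]) simp_all
  then show ?case
    using Suc opt_plus_Some[OF oplus_ominus(1)[OF chainD(1)[OF c] chain_mono[OF c, of 0 k]]
        oplus_ominus(1)[OF chainD(1,2)[OF c], of k]]
    by (simp add: opt_plus_commute lessThan_Suc)
qed

section \<open>Clipping and refining chains\<close>

definition clip :: "'a \<Rightarrow> 'a \<Rightarrow> 'a \<Rightarrow> 'a" where
  "clip x y t = (t \<curlyvee> x) \<curlywedge> y"

lemma clip_closed: "x \<in> C \<Longrightarrow> y \<in> C \<Longrightarrow> t \<in> C \<Longrightarrow> clip x y t \<in> C"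
  by (simp add: clip_def join_closed meet_closed)

lemma iota_clip:
  "x \<in> C \<Longrightarrow> y \<in> C \<Longrightarrow> t \<in> C \<Longrightarrow> \<iota> (clip x y t) = inf (sup (\<iota> t) (\<iota> x)) (\<iota> y)"
  by (simp add: clip_def join_closed meet_closed iota_join iota_meet)

text \<open>Both parts rest on distributivity. Clipping serves to refine one cell of a chain by
  another chain and to restrict a splitting chain to an interval.\<close>

lemma chain_clip:
  assumes e: "chain e m (ezero M) (eone M)" and x: "x \<in> C" and y: "y \<in> C" and xy: "x \<preceq> y"
  shows "chain (clip x y \<circ> e) m x y"
    and "cell \<iota> (clip x y \<circ> e) j = inf (cell \<iota> e j) (\<iota> y - \<iota> x)"
proof -
  note eC = chainD(1)[OF e]
  have le: "\<iota> x \<le> \<iota> y" using xy eff_le_iff_iota x y by blast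
  have "clip x y (ezero M) = x" "clip x y (eone M) = y"
    using le x y ezero_closed eone_closed
    by (auto intro!: iota_eqI simp: clip_closed iota_clip inf.absorb1)
  moreover have "clip x y (e i) \<preceq> clip x y (e (Suc i))" for i
  proof -
    have "inf (sup (\<iota> (e i)) (\<iota> x)) (\<iota> y) \<le> inf (sup (\<iota> (e (Suc i))) (\<iota> x)) (\<iota> y)"
      by (intro inf_mono sup_mono order_refl iota_chain_mono[OF e]) simp
    then show ?thesis using x y eC by (simp add: eff_le_iff_iota clip_closed iota_clip)
  qed
  ultimately show "chain (clip x y \<circ> e) m x y"
    using clip_closed x y eC chainD[OF e] by (simp add: chain_def)
  have "inf (sup b x) y - inf (sup a x) y = inf (b - a) (y - x)" for a b x y :: 'b
    by (simp add: diff_eq inf_sup_distrib1 inf_sup_distrib2 ac_simps)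
  then show "cell \<iota> (clip x y \<circ> e) j = inf (cell \<iota> e j) (\<iota> y - \<iota> x)"
    using x y eC iota_clip by (simp add: cell_def)
qed

definition insert_chain :: "'a \<Rightarrow> (nat \<Rightarrow> 'a) \<Rightarrow> nat \<Rightarrow> 'a" where
  "insert_chain a c k =
     (if even k then c (k div 2) else clip (c (k div 2)) (c (Suc (k div 2))) a)"

text \<open>Inserting the clipped \<open>a\<close> into each gap cuts every old cell into its part
  inside \<open>\<iota> a\<close>, at an even index, and its part outside, at an odd index. New
  cells lie in old ones, so earlier splittings persist.\<close>

lemma chain_insert:
  assumes c: "chain c n x y" and a: "a \<in> C"
  shows "chain (insert_chain a c) (2 * n) x y"
    and "splits (insert_chain a c) (2 * n) (\<iota> a)"
    and "splits c n b \<Longrightarrow> splits (insert_chain a c) (2 * n) b"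
proof -
  note cC = chainD(1)[OF c]
  let ?d = "insert_chain a c"
  have d: "?d (2 * k) = c k" "?d (Suc (2 * k)) = clip (c k) (c (Suc k)) a"
    "?d (Suc (Suc (2 * k))) = c (Suc k)" for k
    by (auto simp: insert_chain_def)
  have m: "\<iota> (c k) \<le> \<iota> (c (Suc k))" for k using iota_chain_mono[OF c] by simp
  have i: "\<iota> (?d (Suc (2 * k))) = inf (sup (\<iota> a) (\<iota> (c k))) (\<iota> (c (Suc k)))" for k
    using cC a iota_clip d by simp
  have closed: "?d k \<in> C" for k using cC a clip_closed by (simp add: insert_chain_def)
  have "?d k \<preceq> ?d (Suc k)" for k
  proof (cases "even k")
    case True
    then obtain j where "k = 2 * j" by blast
    then show ?thesis using eff_le_iff_iota[OF closed[of k] closed[of "Suc k"]] i[of j] m[of j] d[of j] by simp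
  next
    case False
    then obtain j where "k = Suc (2 * j)" by (auto elim: oddE)
    then show ?thesis using eff_le_iff_iota[OF closed[of k] closed[of "Suc k"]] i[of j] m[of j] d[of j] by simp
  qed
  moreover have "?d k = y" if "2 * n \<le> k" for k
  proof -
    have "c (k div 2) = y" "c (Suc (k div 2)) = y" using that chainD(5)[OF c] by auto
    moreover have "clip y y a = y"
      using chain_between(2)[OF c] a by (intro iota_eqI) (simp_all add: clip_closed iota_clip inf.absorb2)
    ultimately show ?thesis by (auto simp: insert_chain_def)
  qed
  ultimately show "chain ?d (2 * n) x y"
    using closed d(1)[of 0] chainD(3)[OF c] by (simp add: chain_def)
  have lo: "cell \<iota> ?d (2 * k) = inf (cell \<iota> c k) (\<iota> a)" for k
    using i[of k] d[of k] by (simp add: cell_def diff_eq inf_sup_distrib1 inf_sup_distrib2 ac_simps)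
  have hi: "cell \<iota> ?d (Suc (2 * k)) = cell \<iota> c k - \<iota> a" for k
    using i[of k] d[of k] by (simp add: cell_def diff_eq inf_sup_distrib1 inf_sup_distrib2 ac_simps)
  have cases: "\<exists>j<n. cell \<iota> ?d k = inf (cell \<iota> c j) (\<iota> a) \<or> cell \<iota> ?d k = cell \<iota> c j - \<iota> a"
    if "k < 2 * n" for k
  proof -
    have "k = 2 * (k div 2) \<or> k = Suc (2 * (k div 2))" "k div 2 < n" using that by auto
    then show ?thesis using lo hi by metis
  qed
  show "splits ?d (2 * n) (\<iota> a)"
    unfolding splits_def
  proof (intro allI impI)
    fix k assume "k < 2 * n"
    then show "cell \<iota> ?d k \<le> \<iota> a \<or> inf (cell \<iota> ?d k) (\<iota> a) = bot"
      using cases[of k] by (auto simp: diff_eq inf_assoc)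
  qed
  show "splits ?d (2 * n) b" if "splits c n b"
    unfolding splits_def
  proof (intro allI impI)
    fix k assume "k < 2 * n"
    then obtain j where j: "j < n" "cell \<iota> ?d k \<le> cell \<iota> c j"
      using cases[of k] by (auto simp: diff_eq)
    then have "cell \<iota> c j \<le> b \<or> inf (cell \<iota> c j) b = bot" using that by (auto simp: splits_def)
    then show "cell \<iota> ?d k \<le> b \<or> inf (cell \<iota> ?d k) b = bot"
    proof
      assume "cell \<iota> c j \<le> b"
      then show ?thesis using j(2) by auto
    next
      assume "inf (cell \<iota> c j) b = bot"
      then have "inf (cell \<iota> ?d k) b \<le> bot" using inf_mono[OF j(2) order_refl[of b]] by simp
      then show ?thesis by (simp add: bot_unique)
    qed
  qed
qed

lemma trivial_chain: "chain (\<lambda>i. if i = 0 then ezero M else eone M) 1 (ezero M) (eone M)"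
  using ezero_closed eone_closed eff_le_zero eff_le_one by (auto simp: chain_def)

lemma splits_finite:
  assumes "finite X" "X \<subseteq> C"
  shows "\<exists>c n. chain c n (ezero M) (eone M) \<and> (\<forall>a\<in>X. splits c n (\<iota> a))"
  using assms
proof (induction X)
  case empty
  then show ?case using trivial_chain by blast
next
  case (insert a X)
  then obtain c n where "chain c n (ezero M) (eone M)" "\<forall>a\<in>X. splits c n (\<iota> a)" by auto
  then show ?case using chain_insert insert.prems by (metis insert_iff insert_subset)
qed

section \<open>Every element is split by some chain\<close>

lemma splits_bot: "splits c n bot"
  by (simp add: splits_def)

lemma splits_compl: "splits c n b \<Longrightarrow> splits c n (- b)"
  by (auto simp: splits_def inf_shunt)

lemma splits_inf: "splits c n a \<Longrightarrow> splits c n b \<Longrightarrow> splits c n (inf a b)"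
proof (unfold splits_def, intro allI impI)
  fix i
  assume "\<forall>i<n. cell \<iota> c i \<le> a \<or> inf (cell \<iota> c i) a = bot"
    "\<forall>i<n. cell \<iota> c i \<le> b \<or> inf (cell \<iota> c i) b = bot" "i < n"
  then consider "cell \<iota> c i \<le> inf a b" | "inf (cell \<iota> c i) a = bot" | "inf (cell \<iota> c i) b = bot" by auto
  then show "cell \<iota> c i \<le> inf a b \<or> inf (cell \<iota> c i) (inf a b) = bot"
    by cases (simp, simp add: inf_assoc[symmetric], simp add: inf_left_commute)
qed

lemma splits_sup: "splits c n a \<Longrightarrow> splits c n b \<Longrightarrow> splits c n (sup a b)"
  using splits_compl[OF splits_inf[OF splits_compl splits_compl], of c n a b] by simp

text \<open>The elements split by a fixed chain form a Boolean subalgebra, so it suffices to split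
  the finitely many generators in one Boolean expression for \<open>b\<close>.\<close>

lemma finitely_supported:
  "\<exists>X. finite X \<and> X \<subseteq> C \<and> (\<forall>c n. (\<forall>a\<in>X. splits c n (\<iota> a)) \<longrightarrow> splits c n b)"
proof -
  have "b \<in> boolean_generated (\<iota> ` C)" using R_gen by (auto simp: R_generated_def)
  then show ?thesis
  proof induction
    case (base x)
    then obtain a where "a \<in> C" "x = \<iota> a" by blast
    then show ?case by (intro exI[of _ "{a}"]) auto
  next
    case bot
    then show ?case using splits_bot by blast
  next
    case (compl x)
    then show ?case using splits_compl by meson
  next
    case (inf x y)
    then obtain X Y where "finite X" "X \<subseteq> C" "\<forall>c n. (\<forall>a\<in>X. splits c n (\<iota> a)) \<longrightarrow> splits c n x"
       "finite Y" "Y \<subseteq> C" "\<forall>c n. (\<forall>a\<in>Y. splits c n (\<iota> a)) \<longrightarrow> splits c n y" by blast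
    then show ?case using splits_inf by (intro exI[of _ "X \<union> Y"]) auto
  next
    case (sup x y)
    then obtain X Y where "finite X" "X \<subseteq> C" "\<forall>c n. (\<forall>a\<in>X. splits c n (\<iota> a)) \<longrightarrow> splits c n x"
       "finite Y" "Y \<subseteq> C" "\<forall>c n. (\<forall>a\<in>Y. splits c n (\<iota> a)) \<longrightarrow> splits c n y" by blast
    then show ?case using splits_sup by (intro exI[of _ "X \<union> Y"]) auto
  qed
qed

text \<open>Since \<open>finitely_supported\<close> speaks of all chains, the two supports can be
  united before a chain is chosen.\<close>

lemma common_splitting:
  "\<exists>c n. chain c n (ezero M) (eone M) \<and> splits c n a \<and> splits c n b"
proof -
  obtain X Y where X: "finite X" "X \<subseteq> C" "\<forall>c n. (\<forall>a\<in>X. splits c n (\<iota> a)) \<longrightarrow> splits c n a"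
    and Y: "finite Y" "Y \<subseteq> C" "\<forall>c n. (\<forall>a\<in>Y. splits c n (\<iota> a)) \<longrightarrow> splits c n b"
    using finitely_supported by metis
  obtain c n where "chain c n (ezero M) (eone M)" "\<forall>a\<in>X \<union> Y. splits c n (\<iota> a)"
    using splits_finite[of "X \<union> Y"] X Y by auto
  then show ?thesis using X Y by blast
qed

end

section \<open>The value of a chain\<close>

lemma bsymdiff_bot [simp]: "bsymdiff bot x = x" "bsymdiff x bot = x"
  by (simp_all add: bsymdiff_def diff_eq)

lemma inf_bsymdiff: "inf z (bsymdiff a b) = bsymdiff (inf z a) (inf z b)"
  by (simp add: bsymdiff_def diff_eq inf_sup_distrib1 inf_sup_distrib2 ac_simps)

lemma bsymdiff_assoc: "bsymdiff (bsymdiff a b) c = bsymdiff a (bsymdiff b c)"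
  by (simp add: bsymdiff_def diff_eq inf_sup_distrib1 inf_sup_distrib2 ac_simps)

lemma foldr_bsymdiff:
  "foldr bsymdiff xs y = bsymdiff (foldr bsymdiff xs bot) y"
  by (induction xs) (simp_all add: bsymdiff_assoc)

text \<open>Below \<open>z\<close> the entries of \<open>ys\<close> vanish and those of
  \<open>zs\<close> all become \<open>z\<close>, so the symmetric difference counts the latter
  modulo 2.\<close>

lemma inf_foldr_bsymdiff:
  assumes "\<And>y. y \<in> set ys \<Longrightarrow> inf z y = bot" and "\<And>y. y \<in> set zs \<Longrightarrow> z \<le> y"
  shows "inf z (foldr bsymdiff (ys @ zs) bot) = (if odd (length zs) then z else bot)"
proof -
  have "inf z (foldr bsymdiff zs bot) = (if odd (length zs) then z else bot)"
    using assms(2)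
  proof (induction zs)
    case (Cons y zs)
    then show ?case by (auto simp: inf_bsymdiff inf.absorb1) (auto simp: bsymdiff_def diff_eq)
  qed simp
  moreover have "inf z (foldr bsymdiff ys bot) = bot"
    using assms(1) by (induction ys) (simp_all add: inf_bsymdiff)
  ultimately show ?thesis using foldr_bsymdiff[of ys "foldr bsymdiff zs bot"] by (simp add: inf_bsymdiff)
qed

context mv_boolean
begin

text \<open>Option-valued because the partial sum could be undefined; \<open>val_defined\<close>
  excludes this for chains starting at 0.\<close>

definition val :: "(nat \<Rightarrow> 'a) \<Rightarrow> nat \<Rightarrow> 'b \<Rightarrow> 'a option" where
  "val c n b =
     osum.F (\<lambda>i. if cell \<iota> c i \<le> b then Some (c (Suc i) \<ominus> c i) else Some (ezero M)) {..<n}"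

text \<open>An empty cell lies below every \<open>b\<close> and so passes the test in
  \<open>val\<close> even when it is also disjoint from \<open>b\<close>; this makes its
  contribution harmless.\<close>

lemma ominus_eq_zero_of_cell:
  assumes "chain c n x y" "cell \<iota> c i = bot"
  shows "c (Suc i) \<ominus> c i = ezero M"
proof -
  have "\<iota> (c (Suc i)) = \<iota> (c i)"
    using iota_chain_mono[OF assms(1), of i "Suc i"] assms(2) by (simp add: cell_def diff_eq_bot_iff)
  then have "c (Suc i) = c i" using iota_eqI chainD(1)[OF assms(1)] by blast
  then show ?thesis using ominus_self chainD(1)[OF assms(1)] by simp
qed

text \<open>Inside each cell of \<open>c\<close> the clipped chain \<open>e\<close> telescopes to
  the difference of that cell. The result is a double sum over intersections of cells, ready for an
  exchange of summations.\<close>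

lemma val_refine:
  assumes c: "chain c n (ezero M) (eone M)" and e: "chain e m (ezero M) (eone M)"
    and s: "splits c n b"
  shows "val c n b = osum.F (\<lambda>i. osum.F (\<lambda>j.
    if inf (cell \<iota> c i) (cell \<iota> e j) \<le> b
    then Some (clip (c i) (c (Suc i)) (e (Suc j)) \<ominus> clip (c i) (c (Suc i)) (e j))
    else Some (ezero M)) {..<m}) {..<n}"
  unfolding val_def
proof (rule osum.cong[OF refl])
  fix i assume i: "i \<in> {..<n}"
  let ?r = "clip (c i) (c (Suc i)) \<circ> e"
  let ?t = "\<lambda>j. if inf (cell \<iota> c i) (cell \<iota> e j) \<le> b
    then Some (clip (c i) (c (Suc i)) (e (Suc j)) \<ominus> clip (c i) (c (Suc i)) (e j))
    else Some (ezero M)"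
  note r = chain_clip[OF e chainD(1)[OF c] chainD(1)[OF c] chainD(2)[OF c], of i]
  have rc: "cell \<iota> ?r j = inf (cell \<iota> c i) (cell \<iota> e j)" for j
    using r(2)[of j] by (simp add: cell_def inf_commute)
  have "osum.F ?t {..<m}
      = (if cell \<iota> c i \<le> b then Some (c (Suc i) \<ominus> c i) else Some (ezero M))"
  proof (cases "cell \<iota> c i \<le> b")
    case True
    then have "osum.F ?t {..<m} = osum.F (\<lambda>j. Some (?r (Suc j) \<ominus> ?r j)) {..<m}"
      by (intro osum.cong) (auto simp: le_infI1)
    also have "\<dots> = Some (c (Suc i) \<ominus> c i)"
      using osum_telescope[OF r(1)] chainD(3,4)[OF r(1)] by simp
    finally show ?thesis using True by simp
  next
    case False
    then have dis: "inf (cell \<iota> c i) b = bot" using s i by (auto simp: splits_def)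
    \<comment> \<open>The test can still succeed for an empty intersection, whose difference is
      zero.\<close>
    have "?t j = Some (ezero M)" for j
    proof (cases "inf (cell \<iota> c i) (cell \<iota> e j) \<le> b")
      case True
      then have "cell \<iota> ?r j \<le> inf (cell \<iota> c i) b" unfolding rc by simp
      then have "cell \<iota> ?r j = bot" unfolding dis by (simp add: bot_unique)
      then show ?thesis using ominus_eq_zero_of_cell[OF r(1)] by simp
    qed simp
    then show ?thesis using False osum.neutral by simp
  qed
  then show "(if cell \<iota> c i \<le> b then Some (c (Suc i) \<ominus> c i) else Some (ezero M)) = osum.F ?t {..<m}"
    by simp
qed

text \<open>Refining either chain by the other gives the same intersections of cells. Equal cells
  have equal differences, so the two double sums differ only in the order of summation.\<close>

lemma val_independent:
  assumes c: "chain c n (ezero M) (eone M)" "splits c n b"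
    and e: "chain e m (ezero M) (eone M)" "splits e m b"
  shows "val c n b = val e m b"
proof -
  have eq: "clip (c i) (c (Suc i)) (e (Suc j)) \<ominus> clip (c i) (c (Suc i)) (e j)
      = clip (e j) (e (Suc j)) (c (Suc i)) \<ominus> clip (e j) (e (Suc j)) (c i)" for i j
  proof -
    note 1 = chain_clip[OF e(1) chainD(1)[OF c(1)] chainD(1)[OF c(1)] chainD(2)[OF c(1)], of i]
    note 2 = chain_clip[OF c(1) chainD(1)[OF e(1)] chainD(1)[OF e(1)] chainD(2)[OF e(1)], of j]
    show ?thesis
      by (rule ominus_eq_of_iota_diff_eq)
        (use chainD(1,2)[OF 1(1)] chainD(1,2)[OF 2(1)] 1(2)[of j] 2(2)[of i]
         in \<open>simp_all add: cell_def inf_commute\<close>)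
  qed
  show ?thesis
    unfolding val_refine[OF c(1) e(1) c(2)] val_refine[OF e(1) c(1) e(2)]
    by (subst osum.swap, intro osum.cong refl) (simp only: eq inf_commute[of "cell \<iota> c _"])
qed

text \<open>The partial sum stays below \<open>c k\<close>, and \<open>c k\<close> has a sum with
  \<open>c (Suc k) \<ominus> c k\<close>; hence so does the partial sum, by monotonicity.\<close>

lemma val_defined:
  assumes c: "chain c n (ezero M) y"
  shows "\<exists>s\<in>C. val c k b = Some s \<and> s \<preceq> c k"
proof (induction k)
  case 0
  then show ?case using ezero_closed eff_le_zero chainD(1)[OF c] by (simp add: val_def)
next
  case (Suc k)
  then obtain s where s: "s \<in> C" "val c k b = Some s" "s \<preceq> c k" by blast
  have v: "val c (Suc k) b =
      opt_plus (if cell \<iota> c k \<le> b then Some (c (Suc k) \<ominus> c k) else Some (ezero M)) (Some s)"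
    using s(2) by (simp add: val_def lessThan_Suc)
  note d = oplus_ominus[OF chainD(1,2)[OF c], of k]
  show ?case
  proof (cases "cell \<iota> c k \<le> b")
    case True
    then have "val c (Suc k) b = oplus M s (c (Suc k) \<ominus> c k)"
      using v opt_plus_Some[OF s(1) d(1)] by (simp add: opt_plus_commute)
    moreover obtain r where "oplus M s (c (Suc k) \<ominus> c k) = Some r" "r \<preceq> c (Suc k)"
      using oplus_mono[OF s(1) d(1) s(3) d(2)] by blast
    ultimately show ?thesis using oplus_closed[OF s(1) d(1)] by auto
  next
    case False
    then have "val c (Suc k) b = Some s" using v by (simp add: opt_plus_def)
    then show ?thesis using s eff_le_trans chainD(2)[OF c] by blast
  qed
qed

lemma osum_odd_indices:
  "osum.F (\<lambda>i. if odd i then g i else Some (ezero M)) {..<Suc (2 * N)}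
    = osum.F (\<lambda>k. g (Suc (2 * k))) {..<N}"
  by (induction N) (simp_all add: lessThan_Suc opt_plus_def[of "Some (ezero M)"])

lemma chain_of_chain_rep:
  assumes "chain_rep (eff_order M) \<iota> x xs"
  shows "\<exists>c n. chain c n (ezero M) (eone M) \<and> splits c n x \<and>
    oplus_list M (chain_diffs M xs) = val c n x"
proof -
  have xsC: "xs ! i \<in> C" if "i < length xs" for i
    using assms that by (auto simp: chain_rep_def)
  have sorted: "xs ! i \<preceq> xs ! j" if "i \<le> j" "j < length xs" for i j
    using assms that xsC eff_le_refl
    by (cases "i = j") (auto simp: chain_rep_def sorted_wrt_iff_nth_less)
  have x: "x = foldr bsymdiff (map \<iota> xs) bot" using assms by (simp add: chain_rep_def)
  obtain N where N: "length xs = 2 * N" using assms by (auto simp: chain_rep_def)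
  \<comment> \<open>Prepending 0 shifts positions by one, so the summands of phi are the differences
    over the cells with odd index. The final 1 sits at index \<open>2 * N + 1\<close>.\<close>
  define c where "c i = (if i = 0 then ezero M else if i \<le> 2 * N then xs ! (i - 1) else eone M)" for i
  define n where "n = Suc (2 * N)"
  have cSuc: "c (Suc j) = xs ! j" if "j < 2 * N" for j using that by (simp add: c_def)
  have closed: "c i \<in> C" for i using xsC N ezero_closed eone_closed by (simp add: c_def)
  have "c i \<preceq> c (Suc i)" for i
    using closed[of i] closed[of "Suc i"] eff_le_zero eff_le_one sorted[of "i - 1" i] N
    by (cases "i = 0"; cases "i < 2 * N") (auto simp: c_def)
  then have c: "chain c n (ezero M) (eone M)" using closed by (simp add: chain_def c_def n_def)
  have inf_cell: "inf (cell \<iota> c i) x = (if odd i then cell \<iota> c i else bot)" if "i < n" for i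
  proof -
    \<comment> \<open>Entries before position \<open>i\<close> lie below
      \<open>\<iota> (c i)\<close>, those from \<open>i\<close> on above
      \<open>\<iota> (c (Suc i))\<close>; the latter number \<open>2 * N - i\<close>, which has the
      parity of \<open>i\<close>.\<close>
    have "inf (cell \<iota> c i) (foldr bsymdiff (map \<iota> (take i xs) @ map \<iota> (drop i xs)) bot) =
      (if odd (length (map \<iota> (drop i xs))) then cell \<iota> c i else bot)"
    proof (rule inf_foldr_bsymdiff)
      fix y assume "y \<in> set (map \<iota> (take i xs))"
      then obtain j where j: "j < i" "j < 2 * N" "y = \<iota> (xs ! j)" using N by (auto simp: in_set_conv_nth)
      then have "y \<le> \<iota> (c i)" using cSuc[of j] iota_chain_mono[OF c, of "Suc j" i] by simp
      then show "inf (cell \<iota> c i) y = bot"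
        by (simp add: cell_def diff_eq inf_shunt inf.coboundedI2)
    next
      fix y assume "y \<in> set (map \<iota> (drop i xs))"
      then obtain j where "j < length (drop i xs)" "y = \<iota> (drop i xs ! j)"
        by (auto simp: in_set_conv_nth)
      then have j: "i + j < 2 * N" "y = \<iota> (xs ! (i + j))" using N by auto
      then have "\<iota> (c (Suc i)) \<le> y"
        using cSuc[of "i + j"] iota_chain_mono[OF c, of "Suc i" "Suc (i + j)"] by simp
      then show "cell \<iota> c i \<le> y" by (simp add: cell_def diff_eq inf.coboundedI1)
    qed
    moreover have "map \<iota> (take i xs) @ map \<iota> (drop i xs) = map \<iota> xs"
      by (simp flip: map_append)
    moreover have "odd (length (map \<iota> (drop i xs))) \<longleftrightarrow> odd i" using that N by (auto simp: n_def)
    ultimately show ?thesis using x by simp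
  qed
  have "splits c n x"
    unfolding splits_def using inf_cell by (metis inf.absorb_iff1)
  moreover have "oplus_list M (chain_diffs M xs) = val c n x"
  proof -
    let ?g = "\<lambda>i. Some (c (Suc i) \<ominus> c i)"
    have diffs: "length (chain_diffs M xs) = N"
      "chain_diffs M xs ! k = c (Suc (Suc (2 * k))) \<ominus> c (Suc (2 * k))" if "k < N" for k
      using that N by (auto simp: chain_diffs_def c_def)
    have len: "length (chain_diffs M xs) = N" using N by (simp add: chain_diffs_def)
    have "set (chain_diffs M xs) \<subseteq> C"
      using diffs(2) len oplus_ominus(1)[OF chainD(1,2)[OF c]] by (auto simp: in_set_conv_nth)
    then have "oplus_list M (chain_diffs M xs) = osum.F (\<lambda>k. ?g (Suc (2 * k))) {..<N}"
      using oplus_list_eq_osum[of "chain_diffs M xs"] len diffs(2) by simp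
    also have "\<dots> = osum.F (\<lambda>i. if odd i then ?g i else Some (ezero M)) {..<n}"
      unfolding n_def by (rule osum_odd_indices[symmetric])
    also have "\<dots> = val c n x"
      unfolding val_def
    proof (rule osum.cong[OF refl])
      fix i assume "i \<in> {..<n}"
      then have i: "inf (cell \<iota> c i) x = (if odd i then cell \<iota> c i else bot)" using inf_cell by simp
      show "(if odd i then ?g i else Some (ezero M)) =
        (if cell \<iota> c i \<le> x then Some (c (Suc i) \<ominus> c i) else Some (ezero M))"
      proof (cases "odd i")
        case True
        then have "cell \<iota> c i \<le> x" using i by (simp add: inf.absorb_iff1)
        then show ?thesis using True by simp
      next
        case False
        then have "cell \<iota> c i \<le> x \<Longrightarrow> cell \<iota> c i = bot" using i by (simp add: inf.absorb1)
        then show ?thesis using False ominus_eq_zero_of_cell[OF c] by simp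
      qed
    qed
    finally show ?thesis .
  qed
  ultimately show ?thesis using c by blast
qed

text \<open>Append both endpoints of every cell below \<open>x\<close>, in order, so that each stage
  represents \<open>inf x (\<iota> (c k))\<close>. Adjacent selected cells repeat their common
  endpoint, which a weakly increasing chain permits.\<close>

lemma chain_rep_exists: "\<exists>xs. chain_rep (eff_order M) \<iota> x xs"
proof -
  obtain c n where c: "chain c n (ezero M) (eone M)" and s: "splits c n x"
    using common_splitting by blast
  have "\<exists>xs. set xs \<subseteq> C \<and> sorted_wrt (eff_le M) xs \<and> even (length xs) \<and> (\<forall>y\<in>set xs. y \<preceq> c k) \<and>
      foldr bsymdiff (map \<iota> xs) bot = inf x (\<iota> (c k))" if "k \<le> n" for k
    using that
  proof (induction k)
    case 0
    then show ?case using chainD(3)[OF c] by (intro exI[of _ "[]"]) simp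
  next
    case (Suc k)
    then obtain xs where xs: "set xs \<subseteq> C" "sorted_wrt (eff_le M) xs" "even (length xs)"
      "\<forall>y\<in>set xs. y \<preceq> c k" "foldr bsymdiff (map \<iota> xs) bot = inf x (\<iota> (c k))" by auto
    have le: "\<forall>y\<in>set xs. y \<preceq> c (Suc k)" using xs(1,4) eff_le_trans chainD(2)[OF c] by blast
    show ?case
    proof (cases "cell \<iota> c k \<le> x")
      case True
      have m: "\<iota> (c k) \<le> \<iota> (c (Suc k))" using iota_chain_mono[OF c] by simp
      have "bsymdiff (\<iota> (c k)) (\<iota> (c (Suc k))) = cell \<iota> c k"
        using m by (simp add: bsymdiff_def cell_def diff_eq_bot_iff[THEN iffD2])
      moreover have "bsymdiff (inf x (\<iota> (c k))) (cell \<iota> c k) = sup (inf x (\<iota> (c k))) (cell \<iota> c k)"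
      proof -
        have "inf (inf x (\<iota> (c k))) (cell \<iota> c k) = bot"
          by (simp add: cell_def diff_eq ac_simps)
        then have "inf x (\<iota> (c k)) - cell \<iota> c k = inf x (\<iota> (c k))"
          "cell \<iota> c k - inf x (\<iota> (c k)) = cell \<iota> c k"
          by (metis diff_eq inf.absorb1 inf_shunt inf_commute)+
        then show ?thesis by (simp add: bsymdiff_def)
      qed
      moreover have "\<dots> = inf x (\<iota> (c (Suc k)))"
        using True by (simp add: iota_Suc_cell[OF c] inf_sup_distrib1 inf.absorb2)
      ultimately have "foldr bsymdiff (map \<iota> (xs @ [c k, c (Suc k)])) bot = inf x (\<iota> (c (Suc k)))"
        using xs(5) foldr_bsymdiff[of "map \<iota> xs" "cell \<iota> c k"] by simp
      then show ?thesis
        using xs le chainD(1,2)[OF c] eff_le_refl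
        by (intro exI[of _ "xs @ [c k, c (Suc k)]"]) (auto simp: sorted_wrt_append)
    next
      case False
      then have "inf x (cell \<iota> c k) = bot" using s Suc.prems
        by (metis splits_def Suc_le_lessD inf_commute)
      then have "inf x (\<iota> (c k)) = inf x (\<iota> (c (Suc k)))"
        by (simp add: iota_Suc_cell[OF c] inf_sup_distrib1)
      then show ?thesis using xs le by (intro exI[of _ xs]) simp
    qed
  qed
  from this[of n] show ?thesis using chainD(4)[OF c] by (auto simp: chain_rep_def)
qed

section \<open>The map phi and its additivity\<close>

abbreviation "\<phi> \<equiv> phi_M M \<iota>"

text \<open>Every chain representation evaluates like some splitting chain, and all of these agree.
  As a representation exists, the \<open>THE\<close> in \<open>phi_M\<close> denotes this common
  value.\<close>

lemma val_eq_phi: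
  assumes "chain c n (ezero M) (eone M)" "splits c n b"
  shows "val c n b = Some (\<phi> b)" and "\<phi> b \<in> C"
proof -
  obtain s where s: "s \<in> C" "val c n b = Some s" using val_defined assms by blast
  have eq: "oplus_list M (chain_diffs M xs) = Some s" if "chain_rep (eff_order M) \<iota> b xs" for xs
    using chain_of_chain_rep[OF that] val_independent assms s by metis
  then have "\<phi> b = s"
    unfolding phi_M_def using chain_rep_exists[of b] by (intro the_equality) auto
  then show "val c n b = Some (\<phi> b)" "\<phi> b \<in> C" using s by auto
qed

lemma phi_closed: "\<phi> b \<in> C"
  using val_eq_phi(2) common_splitting by blast

text \<open>On a chain splitting both, a nonempty cell below \<open>sup a b\<close> lies below
  exactly one of \<open>a\<close> and \<open>b\<close>, so the sums add termwise.\<close>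

lemma phi_additive:
  assumes "inf a b = bot"
  shows "oplus M (\<phi> a) (\<phi> b) = Some (\<phi> (sup a b))"
proof -
  obtain c n where c: "chain c n (ezero M) (eone M)" "splits c n a" "splits c n b"
    using common_splitting by blast
  let ?v = "\<lambda>x i. if cell \<iota> c i \<le> x then Some (c (Suc i) \<ominus> c i) else Some (ezero M)"
  have "val c n (sup a b) = osum.F (\<lambda>i. opt_plus (?v a i) (?v b i)) {..<n}"
    unfolding val_def
  proof (rule osum.cong[OF refl])
    fix i assume i: "i \<in> {..<n}"
    have iff: "cell \<iota> c i \<le> sup a b \<longleftrightarrow> cell \<iota> c i \<le> a \<or> cell \<iota> c i \<le> b"
    proof
      assume *: "cell \<iota> c i \<le> sup a b"
      show "cell \<iota> c i \<le> a \<or> cell \<iota> c i \<le> b"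
      proof (rule ccontr)
        assume "\<not> ?thesis"
        then have "inf (cell \<iota> c i) a = bot" "inf (cell \<iota> c i) b = bot" "cell \<iota> c i \<noteq> bot"
          using c i by (auto simp: splits_def)
        then show False using * by (metis inf.absorb1 inf_sup_distrib1 sup_bot_left)
      qed
    qed (auto intro: le_supI1 le_supI2)
    have "cell \<iota> c i \<le> a \<Longrightarrow> cell \<iota> c i \<le> b \<Longrightarrow> cell \<iota> c i = bot"
      using assms by (metis bot_unique le_inf_iff)
    then show "?v (sup a b) i = opt_plus (?v a i) (?v b i)"
      using iff ominus_eq_zero_of_cell[OF c(1), of i] by (auto simp: opt_plus_def)
  qed
  also have "\<dots> = opt_plus (val c n a) (val c n b)" unfolding val_def by (rule osum.distrib)
  finally show ?thesis
    using val_eq_phi(1)[OF c(1) splits_sup[OF c(2,3)]] val_eq_phi[OF c(1,2)] val_eq_phi[OF c(1,3)]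
    by (simp add: opt_plus_Some)
qed

lemma phi_iota:
  assumes a: "a \<in> C"
  shows "\<phi> (\<iota> a) = a"
proof -
  define c where "c i = (if i = 0 then ezero M else if i = 1 then a else eone M)" for i :: nat
  have c: "chain c 2 (ezero M) (eone M)"
    using a ezero_closed eone_closed eff_le_zero eff_le_one eff_le_refl by (auto simp: chain_def c_def)
  have cell: "cell \<iota> c 0 = \<iota> a" "cell \<iota> c 1 = - \<iota> a"
    by (simp_all add: cell_def c_def diff_eq)
  then have "splits c 2 (\<iota> a)"
    by (auto simp: splits_def less_2_cases_iff)
  then have "Some (\<phi> (\<iota> a)) = val c 2 (\<iota> a)" using val_eq_phi c by simp
  also have "\<dots> = Some a"
  proof -
    \<comment> \<open>If \<open>a\<close> is 1, the second cell passes the test in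
      \<open>val\<close>, but it is empty and contributes zero.\<close>
    have "cell \<iota> c 1 \<le> \<iota> a \<Longrightarrow> cell \<iota> c 1 = bot"
      unfolding cell by (metis compl_inf_bot inf.absorb1)
    then have "(if cell \<iota> c (Suc 0) \<le> \<iota> a then Some (c (Suc (Suc 0)) \<ominus> c (Suc 0)) else Some (ezero M))
        = Some (ezero M)"
      using ominus_eq_zero_of_cell[OF c, of 1] by simp
    moreover have "c 1 \<ominus> c 0 = a" using ominus_zero[OF a] by (simp add: c_def)
    ultimately show ?thesis
      using cell(1) by (simp add: val_def numeral_2_eq_2 lessThan_Suc opt_plus_def[of "Some (ezero M)"] del: if_split)
  qed
  finally show ?thesis by simp
qed

lemma phi_bot: "\<phi> bot = ezero M" and phi_top: "\<phi> top = eone M"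
  using phi_iota[OF ezero_closed] phi_iota[OF eone_closed] by simp_all

lemma phi_sup_diff:
  assumes "a \<le> b"
  shows "oplus M (\<phi> a) (\<phi> (b - a)) = Some (\<phi> b)"
proof -
  have "inf a (b - a) = bot" "sup a (b - a) = b"
    using assms by (simp_all add: diff_eq inf_left_commute sup_inf_distrib1 sup.absorb2)
  then show ?thesis using phi_additive by metis
qed

lemma phi_diff: "a \<le> b \<Longrightarrow> \<phi> (b - a) = \<phi> b \<ominus> \<phi> a"
  using phi_sup_diff ominus_eqI phi_closed by metis

lemma phi_mono: "a \<le> b \<Longrightarrow> \<phi> a \<preceq> \<phi> b"
  using phi_sup_diff phi_closed unfolding eff_le_def by blast

lemma phi_cell: "chain c n x y \<Longrightarrow> \<phi> (cell \<iota> c i) = c (Suc i) \<ominus> c i"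
  unfolding cell_def using phi_diff iota_chain_mono phi_iota chainD(1) by (metis le_SucI order_refl)

end

section \<open>Translations of intervals\<close>

context mv_boolean
begin

definition equidistant :: "'a \<Rightarrow> 'a \<Rightarrow> 'a \<Rightarrow> 'a \<Rightarrow> bool" where
  "equidistant x y x' y' \<longleftrightarrow>
     x \<in> C \<and> x' \<in> C \<and> x \<preceq> y \<and> x' \<preceq> y' \<and> y \<ominus> x = y' \<ominus> x'"

definition shift :: "'a \<Rightarrow> 'a \<Rightarrow> 'a \<Rightarrow> 'a" where
  "shift x x' t = the (oplus M x' (t \<ominus> x))"

lemma equidistant_sym: "equidistant x y x' y' \<Longrightarrow> equidistant x' y' x y"
  by (auto simp: equidistant_def)

lemma equidistant_closed:
  "equidistant x y x' y' \<Longrightarrow> x \<in> C \<and> y \<in> C \<and> x' \<in> C \<and> y' \<in> C"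
  using eff_le_closed by (auto simp: equidistant_def)

text \<open>As \<open>t \<ominus> x\<close> is at most
  \<open>y \<ominus> x = y' \<ominus> x'\<close>, which has the sum \<open>y'\<close> with
  \<open>x'\<close>, monotonicity defines \<open>x' \<oplus> (t \<ominus> x)\<close> below
  \<open>y'\<close>. Only on such \<open>t\<close> is the \<open>the\<close> in \<open>shift\<close>
  meaningful.\<close>

lemma shift_between:
  assumes e: "equidistant x y x' y'" and t: "x \<preceq> t" "t \<preceq> y"
  shows "oplus M x' (t \<ominus> x) = Some (shift x x' t)" and "shift x x' t \<in> C"
    and "x' \<preceq> shift x x' t" and "shift x x' t \<preceq> y'" and "shift x x' t \<ominus> x' = t \<ominus> x"
proof -
  have x: "x \<in> C" "x' \<in> C" "x \<preceq> y" "x' \<preceq> y'" "y \<ominus> x = y' \<ominus> x'"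
    using e by (auto simp: equidistant_def)
  have tC: "t \<in> C" using eff_le_closed x(1) t(1) .
  note tx = oplus_ominus[OF x(1) t(1)] and yt = oplus_ominus[OF tC t(2)]
    and yx = oplus_ominus[OF x(2,4)]
  have "oplus M (t \<ominus> x) (y \<ominus> t) = Some (y' \<ominus> x')"
    using ominus_oplus_ominus[OF x(1) t] x(5) by simp
  then have "t \<ominus> x \<preceq> y' \<ominus> x'" using yt(1) by (auto simp: eff_le_def)
  moreover have "oplus M (y' \<ominus> x') x' = Some y'" using E1[OF x(2) yx] .
  ultimately obtain r where r: "oplus M (t \<ominus> x) x' = Some r" "r \<preceq> y'"
    using oplus_mono[OF tx(1) x(2)] by blast
  have "oplus M x' (t \<ominus> x) = Some r" using E1[OF tx(1) x(2) r(1)] .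
  moreover from this have "shift x x' t = r" by (simp add: shift_def)
  ultimately show o: "oplus M x' (t \<ominus> x) = Some (shift x x' t)" and "shift x x' t \<preceq> y'"
    using r(2) by auto
  show "shift x x' t \<in> C" using oplus_closed[OF x(2) tx(1) o] .
  show "x' \<preceq> shift x x' t" using o tx(1) by (auto simp: eff_le_def)
  show "shift x x' t \<ominus> x' = t \<ominus> x" using ominus_eqI[OF x(2) tx(1) o] .
qed

lemma shift_shift:
  assumes e: "equidistant x y x' y'" and t: "x \<preceq> t" "t \<preceq> y"
  shows "shift x' x (shift x x' t) = t"
proof -
  have x: "x \<in> C" using e by (simp add: equidistant_def)
  show ?thesis
    unfolding shift_def[of x' x] shift_between(5)[OF assms] using oplus_ominus(2)[OF x t(1)] by simp
qed

text \<open>Adding \<open>t \<ominus> x\<close> and then \<open>s \<ominus> t\<close> to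
  \<open>x'\<close> amounts to adding \<open>s \<ominus> x\<close>.\<close>

lemma shift_mono:
  assumes e: "equidistant x y x' y'" and t: "x \<preceq> t" "t \<preceq> s" "s \<preceq> y"
  shows "shift x x' t \<preceq> shift x x' s" and "shift x x' s \<ominus> shift x x' t = s \<ominus> t"
proof -
  have x: "x \<in> C" "x' \<in> C" using e by (auto simp: equidistant_def)
  have tC: "t \<in> C" using eff_le_closed x(1) t(1) .
  have ty: "t \<preceq> y" using eff_le_trans tC t by blast
  have xs: "x \<preceq> s" using eff_le_trans x t by blast
  note T = shift_between[OF e t(1) ty] and S = shift_between[OF e xs t(3)]
  have d: "t \<ominus> x \<in> C" "s \<ominus> t \<in> C" using oplus_ominus(1) x tC t by auto
  have "Option.bind (oplus M x' (t \<ominus> x)) (\<lambda>u. oplus M u (s \<ominus> t))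
      = Option.bind (oplus M (t \<ominus> x) (s \<ominus> t)) (oplus M x')"
    using oplus_assoc_iff[OF x(2) d] .
  then have "oplus M (shift x x' t) (s \<ominus> t) = Some (shift x x' s)"
    using T(1) S(1) ominus_oplus_ominus[OF x(1) t(1,2)] by simp
  then show "shift x x' t \<preceq> shift x x' s" "shift x x' s \<ominus> shift x x' t = s \<ominus> t"
    using d ominus_eqI[OF T(2) d(2)] by (auto simp: eff_le_def)
qed

lemma eff_le_meet_iff:
  "a \<in> C \<Longrightarrow> b \<in> C \<Longrightarrow> w \<in> C \<Longrightarrow> w \<preceq> a \<curlywedge> b \<longleftrightarrow> w \<preceq> a \<and> w \<preceq> b"
  by (simp add: eff_le_iff_iota meet_closed iota_meet)

lemma join_eff_le_iff:
  "a \<in> C \<Longrightarrow> b \<in> C \<Longrightarrow> w \<in> C \<Longrightarrow> a \<curlyvee> b \<preceq> w \<longleftrightarrow> a \<preceq> w \<and> b \<preceq> w"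
  by (simp add: eff_le_iff_iota join_closed iota_join)

lemma meet_lower: "a \<in> C \<Longrightarrow> b \<in> C \<Longrightarrow> a \<curlywedge> b \<preceq> a" "a \<in> C \<Longrightarrow> b \<in> C \<Longrightarrow> a \<curlywedge> b \<preceq> b"
  and join_upper: "a \<in> C \<Longrightarrow> b \<in> C \<Longrightarrow> a \<preceq> a \<curlyvee> b" "a \<in> C \<Longrightarrow> b \<in> C \<Longrightarrow> b \<preceq> a \<curlyvee> b"
  by (simp_all add: eff_le_iff_iota meet_closed join_closed iota_meet iota_join)

text \<open>Meets and joins of elements of an interval stay in it, so an order isomorphism of
  intervals preserves them; the converse is the same for the inverse translation. Disjointness of
  two cells takes this form.\<close>

lemma shift_meet_join_le_iff:
  assumes e: "equidistant x y x' y'"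
    and "x \<preceq> a" "a \<preceq> y" "x \<preceq> b" "b \<preceq> y" "x \<preceq> c" "c \<preceq> y" "x \<preceq> d" "d \<preceq> y"
  shows "shift x x' a \<curlywedge> shift x x' b \<preceq> shift x x' c \<curlyvee> shift x x' d \<longleftrightarrow> a \<curlywedge> b \<preceq> c \<curlyvee> d"
proof -
  have *: "shift x x' a \<curlywedge> shift x x' b \<preceq> shift x x' c \<curlyvee> shift x x' d"
    if e: "equidistant x y x' y'" and a: "x \<preceq> a" "a \<preceq> y" and b: "x \<preceq> b" "b \<preceq> y"
      and c: "x \<preceq> c" "c \<preceq> y" and d: "x \<preceq> d" "d \<preceq> y" and le: "a \<curlywedge> b \<preceq> c \<curlyvee> d"
    for x y x' y' a b c d
  proof -
    let ?h = "shift x x'" and ?k = "shift x' x"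
    have xy: "x \<in> C" "y \<in> C" "x' \<in> C" "y' \<in> C" using equidistant_closed[OF e] by auto
    have C: "a \<in> C" "b \<in> C" "c \<in> C" "d \<in> C" using eff_le_closed xy(1) a(1) b(1) c(1) d(1) by blast+
    note e' = equidistant_sym[OF e]
    note ha = shift_between(2-4)[OF e a] and hb = shift_between(2-4)[OF e b]
      and hc = shift_between(2-4)[OF e c] and hd = shift_between(2-4)[OF e d]
    let ?m = "?h a \<curlywedge> ?h b" and ?j = "c \<curlyvee> d"
    have m: "?m \<in> C" "x' \<preceq> ?m" "?m \<preceq> ?h a" "?m \<preceq> ?h b"
      using eff_le_meet_iff ha hb xy meet_closed meet_lower by auto
    then have my: "?m \<preceq> y'" using eff_le_trans ha(3) by blast
    have j: "?j \<in> C" "?j \<preceq> y" "c \<preceq> ?j" "d \<preceq> ?j"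
      using join_eff_le_iff c d C xy join_closed join_upper by auto
    then have xj: "x \<preceq> ?j" using eff_le_trans xy(1) c(1) by blast
    note km = shift_between(2-4)[OF e' m(2) my]
    have "?k ?m \<preceq> ?k (?h a)" "?k ?m \<preceq> ?k (?h b)"
      using shift_mono(1)[OF e' m(2) m(3) ha(3)] shift_mono(1)[OF e' m(2) m(4) hb(3)] .
    then have "?k ?m \<preceq> a \<curlywedge> b"
      using shift_shift[OF e a] shift_shift[OF e b] eff_le_meet_iff[OF C(1,2) km(1)] by simp
    then have "?k ?m \<preceq> ?j" using eff_le_trans[OF km(1)] le by blast
    then have hm: "?m \<preceq> ?h ?j"
      using shift_mono(1)[OF e km(2) _ j(2)] shift_shift[OF e' m(2) my] by simp
    let ?n = "?h c \<curlyvee> ?h d"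
    have n: "?n \<in> C" "?n \<preceq> y'" "?h c \<preceq> ?n" "?h d \<preceq> ?n"
      using join_eff_le_iff hc hd xy join_closed join_upper by auto
    then have xn: "x' \<preceq> ?n" using eff_le_trans xy(3) hc(2) by blast
    have "?k (?h c) \<preceq> ?k ?n" "?k (?h d) \<preceq> ?k ?n"
      using shift_mono(1)[OF e' hc(2) n(3,2)] shift_mono(1)[OF e' hd(2) n(4,2)] .
    then have "?j \<preceq> ?k ?n"
      using shift_shift[OF e c] shift_shift[OF e d] join_eff_le_iff C shift_between(2)[OF e' xn n(2)] by simp
    then have "?h ?j \<preceq> ?n"
      using shift_mono(1)[OF e xj] shift_between(4)[OF e' xn n(2)] shift_shift[OF e' xn n(2)] by metis
    then show ?thesis using hm eff_le_trans m(1) by blast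
  qed
  show ?thesis
  proof
    assume "shift x x' a \<curlywedge> shift x x' b \<preceq> shift x x' c \<curlyvee> shift x x' d"
    then have "shift x' x (shift x x' a) \<curlywedge> shift x' x (shift x x' b)
        \<preceq> shift x' x (shift x x' c) \<curlyvee> shift x' x (shift x x' d)"
      using assms shift_between[OF e] by (intro *[OF equidistant_sym[OF e]]) auto
    then show "a \<curlywedge> b \<preceq> c \<curlyvee> d" using assms shift_shift[OF e] by simp
  qed (rule *[OF assms])
qed

lemma chain_shift:
  assumes e: "equidistant x y x' y'" and c: "chain c n x y"
  shows "chain (shift x x' \<circ> c) n x' y'"
proof -
  note b = chain_between(3,4)[OF c]
  have xy: "x \<in> C" "x' \<in> C" "y \<in> C" "y' \<in> C" "x \<preceq> y" "x' \<preceq> y'" "y \<ominus> x = y' \<ominus> x'"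
    using equidistant_closed[OF e] e by (auto simp: equidistant_def)
  have "shift x x' x = x'" using oplus_zero_right xy by (simp add: shift_def ominus_self)
  moreover have "shift x x' y = y'" using oplus_ominus(2)[OF xy(2,6)] xy(7) by (simp add: shift_def)
  ultimately show ?thesis
    using shift_between(2)[OF e b] shift_mono(1)[OF e b(1) chainD(2)[OF c] b(2)] chainD[OF c]
    by (simp add: chain_def)
qed

section \<open>Isomorphisms of Boolean ideals induced by translations\<close>

lemma cells_disjoint_iff:
  assumes "chain c n x y" "chain e m x y"
  shows "inf (cell \<iota> c i) (cell \<iota> e j) = bot \<longleftrightarrow> c (Suc i) \<curlywedge> e (Suc j) \<preceq> c i \<curlyvee> e j"
  using chainD(1)[OF assms(1)] chainD(1)[OF assms(2)]
  by (simp add: cell_def diff_inf_diff_eq_bot_iff eff_le_iff_iota meet_closed join_closed iota_meet iota_join)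

text \<open>For a chain, \<open>p\<close> is thereby the union of the cells with index in
  \<open>S\<close>, described so that it can be checked cell by cell.\<close>

definition selects :: "(nat \<Rightarrow> 'a) \<Rightarrow> nat \<Rightarrow> nat set \<Rightarrow> 'b \<Rightarrow> bool" where
  "selects c n S p \<longleftrightarrow> p \<le> \<iota> (c n) - \<iota> (c 0) \<and>
     (\<forall>i<n. if i \<in> S then cell \<iota> c i \<le> p else inf (cell \<iota> c i) p = bot)"

text \<open>The bound \<open>k\<close> is separate from the length of the chain, so that induction
  can add one cell at a time.\<close>

lemma selects_exists:
  assumes c: "chain c n x y"
  shows "\<exists>p. selects c k S p"
proof (induction k)
  case 0
  then show ?case by (auto simp: selects_def)
next
  case (Suc k)
  then obtain p where p: "selects c k S p" by blast
  have m: "\<iota> (c 0) \<le> \<iota> (c k)" "\<iota> (c k) \<le> \<iota> (c (Suc k))" using iota_chain_mono[OF c] by auto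
  have dis: "inf (cell \<iota> c i) (cell \<iota> c k) = bot" if "i < k" for i
  proof -
    have "\<iota> (c (Suc i)) \<le> \<iota> (c k)" using iota_chain_mono[OF c] that by simp
    then show ?thesis by (simp add: cell_def diff_inf_diff_eq_bot_iff le_supI2 inf.coboundedI1)
  qed
  have pk: "inf (cell \<iota> c k) p = bot" and p_le: "p \<le> \<iota> (c (Suc k)) - \<iota> (c 0)"
  proof -
    have p': "p \<le> \<iota> (c k)" "p \<le> - \<iota> (c 0)" using p by (auto simp: selects_def diff_eq)
    then show "p \<le> \<iota> (c (Suc k)) - \<iota> (c 0)" using m(2) by (auto simp: diff_eq)
    have "inf (cell \<iota> c k) p \<le> inf (- \<iota> (c k)) (\<iota> (c k))"
      using p'(1) by (intro inf_mono) (simp_all add: cell_def diff_eq)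
    then show "inf (cell \<iota> c k) p = bot" by (simp add: bot_unique)
  qed
  have cell_le: "cell \<iota> c k \<le> \<iota> (c (Suc k)) - \<iota> (c 0)"
    using m(1) by (simp add: cell_def diff_eq inf.coboundedI2)
  show ?case
  proof (cases "k \<in> S")
    case True
    have "selects c (Suc k) S (sup p (cell \<iota> c k))"
      using p True p_le cell_le dis
      by (auto simp: selects_def less_Suc_eq inf_sup_distrib1 le_supI1)
    then show ?thesis by blast
  next
    case False
    then have "selects c (Suc k) S p"
      using p p_le pk by (auto simp: selects_def less_Suc_eq)
    then show ?thesis by blast
  qed
qed

text \<open>The graph of the isomorphism of Boolean ideals induced by the translation.\<close>

definition corr :: "'a \<Rightarrow> 'a \<Rightarrow> 'a \<Rightarrow> 'b \<Rightarrow> 'b \<Rightarrow> bool" where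
  "corr x y x' p q \<longleftrightarrow> (\<exists>c n S. chain c n x y \<and> selects c n S p \<and> selects (shift x x' \<circ> c) n S q)"

text \<open>The intersections of cells of both chains cover \<open>p - q\<close>, by
  \<open>cells_cover\<close> used twice. This reduces inclusion to disjointness of cells, which
  translations preserve.\<close>

lemma selects_le_iff:
  assumes c: "chain c n x y" "selects c n S p" and e: "chain e m x y" "selects e m T q"
  shows "p \<le> q \<longleftrightarrow> (\<forall>i<n. \<forall>j<m. i \<in> S \<longrightarrow> j \<notin> T \<longrightarrow> inf (cell \<iota> c i) (cell \<iota> e j) = bot)"
proof (intro iffI allI impI)
  fix i j
  assume "p \<le> q" "i < n" "j < m" "i \<in> S" "j \<notin> T"
  then have "cell \<iota> c i \<le> q" "inf (cell \<iota> e j) q = bot"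
    using c(2) e(2) by (auto simp: selects_def)
  then show "inf (cell \<iota> c i) (cell \<iota> e j) = bot"
    by (metis bot_unique inf_commute inf_mono order_refl)
next
  assume *: "\<forall>i<n. \<forall>j<m. i \<in> S \<longrightarrow> j \<notin> T \<longrightarrow> inf (cell \<iota> c i) (cell \<iota> e j) = bot"
  have p: "p \<le> \<iota> y - \<iota> x" using c chainD(3,4)[OF c(1)] by (simp add: selects_def)
  have "p - q = bot"
  proof (rule cells_cover[OF c(1)])
    show "p - q \<le> \<iota> y - \<iota> x" using p by (metis diff_eq inf.coboundedI1)
    fix i assume i: "i < n"
    show "inf (p - q) (cell \<iota> c i) = bot"
    proof (rule cells_cover[OF e(1)])
      show "inf (p - q) (cell \<iota> c i) \<le> \<iota> y - \<iota> x" using p by (metis diff_eq inf.coboundedI1)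
      fix j assume j: "j < m"
      consider "inf (cell \<iota> c i) p = bot" | "cell \<iota> e j \<le> q" | "inf (cell \<iota> c i) (cell \<iota> e j) = bot"
        using c(2) e(2) * i j unfolding selects_def by metis
      then show "inf (inf (p - q) (cell \<iota> c i)) (cell \<iota> e j) = bot"
      proof cases
        case 1
        have "inf (inf (p - q) (cell \<iota> c i)) (cell \<iota> e j) \<le> inf (cell \<iota> c i) p"
          by (simp add: diff_eq inf.coboundedI1 inf.coboundedI2)
        then show ?thesis using 1 by (simp add: bot_unique)
      next
        case 2
        have "inf (inf (p - q) (cell \<iota> c i)) (cell \<iota> e j) \<le> inf (- q) q"
          using 2 by (intro inf_mono) (simp_all add: diff_eq inf.coboundedI1)
        then show ?thesis by (simp add: bot_unique)
      next
        case 3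
        then show ?thesis by (simp add: inf_assoc)
      qed
    qed
  qed
  then show "p \<le> q" by (simp add: diff_eq_bot_iff)
qed

text \<open>Inclusion is a matter of which cells are disjoint. Applied in both directions of an
  equality, this also shows that the correspondence is single-valued and injective, whatever chains
  witness it.\<close>

lemma corr_le_iff:
  assumes e: "equidistant x y x' y'" and "corr x y x' p q" "corr x y x' p2 q2"
  shows "p \<le> p2 \<longleftrightarrow> q \<le> q2"
proof -
  obtain c n S where c: "chain c n x y" "selects c n S p" "selects (shift x x' \<circ> c) n S q"
    using assms(2) by (auto simp: corr_def)
  obtain d m T where d: "chain d m x y" "selects d m T p2" "selects (shift x x' \<circ> d) m T q2"
    using assms(3) by (auto simp: corr_def)
  note c' = chain_shift[OF e c(1)] and d' = chain_shift[OF e d(1)]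
  have "inf (cell \<iota> (shift x x' \<circ> c) i) (cell \<iota> (shift x x' \<circ> d) j) = bot \<longleftrightarrow>
      inf (cell \<iota> c i) (cell \<iota> d j) = bot" for i j
    unfolding cells_disjoint_iff[OF c(1) d(1)] cells_disjoint_iff[OF c' d']
    using shift_meet_join_le_iff[OF e] chain_between(3,4)[OF c(1)] chain_between(3,4)[OF d(1)] by simp
  then show ?thesis
    unfolding selects_le_iff[OF c(1,2) d(1,2)] selects_le_iff[OF c' c(3) d' d(3)] by simp
qed

lemma corr_total:
  assumes e: "equidistant x y x' y'" and p: "p \<le> \<iota> y - \<iota> x"
  shows "\<exists>q. corr x y x' p q"
proof -
  obtain c n where c: "chain c n (ezero M) (eone M)" "splits c n p" using common_splitting by blast
  have xy: "x \<in> C" "y \<in> C" "x \<preceq> y" using equidistant_closed[OF e] e by (auto simp: equidistant_def)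
  \<comment> \<open>A chain splitting \<open>p\<close>, clipped to the interval, still splits
    \<open>p\<close>, since its cells only shrink; \<open>?S\<close> records those below
    \<open>p\<close>.\<close>
  let ?d = "clip x y \<circ> c" and ?S = "{i. cell \<iota> (clip x y \<circ> c) i \<le> p}"
  note d = chain_clip[OF c(1) xy]
  have "selects ?d n ?S p"
    unfolding selects_def
  proof (intro conjI allI impI)
    show "p \<le> \<iota> (?d n) - \<iota> (?d 0)" using chainD(3,4)[OF d(1)] p by simp
    fix i assume i: "i < n"
    have "inf (cell \<iota> ?d i) p = bot" if "i \<notin> ?S"
    proof -
      have "\<not> cell \<iota> c i \<le> p" using that d(2)[of i] inf.coboundedI1 by auto
      then have "inf (cell \<iota> c i) p = bot" using c(2) i by (auto simp: splits_def)
      then show ?thesis unfolding d(2) by (metis inf_assoc inf_commute inf_bot_left)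
    qed
    then show "if i \<in> ?S then cell \<iota> ?d i \<le> p else inf (cell \<iota> ?d i) p = bot" by simp
  qed
  moreover obtain q where "selects (shift x x' \<circ> ?d) n ?S q"
    using selects_exists[OF chain_shift[OF e d(1)]] by blast
  ultimately show ?thesis using d(1) unfolding corr_def by blast
qed

lemma corr_sym:
  assumes e: "equidistant x y x' y'" and "corr x y x' p q"
  shows "corr x' y' x q p"
proof -
  obtain c n S where c: "chain c n x y" "selects c n S p" "selects (shift x x' \<circ> c) n S q"
    using assms(2) by (auto simp: corr_def)
  have "shift x' x \<circ> (shift x x' \<circ> c) = c"
    using shift_shift[OF e] chain_between(3,4)[OF c(1)] by auto
  then show ?thesis using chain_shift[OF e c(1)] c unfolding corr_def by metis
qed

text \<open>Truncate \<open>p\<close> and \<open>q\<close> at the k-th points of their chains. In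
  each step both values grow by the same difference, or both by zero.\<close>

lemma phi_selects:
  assumes c: "chain c n x y" and p: "selects c n S p" and e: "chain e n x' y'" and q: "selects e n S q"
    and eq: "\<And>i. c (Suc i) \<ominus> c i = e (Suc i) \<ominus> e i"
  shows "\<phi> p = \<phi> q"
proof -
  have step: "oplus M (\<phi> (inf p (\<iota> (c k)))) (if k \<in> S then c (Suc k) \<ominus> c k else ezero M)
      = Some (\<phi> (inf p (\<iota> (c (Suc k)))))"
    if c: "chain c n x y" and p: "selects c n S p" and k: "k < n" for c x y p k
  proof -
    have "inf (inf p (\<iota> (c k))) (inf p (cell \<iota> c k)) = bot"
      by (simp add: cell_def diff_eq ac_simps)
    moreover have "sup (inf p (\<iota> (c k))) (inf p (cell \<iota> c k)) = inf p (\<iota> (c (Suc k)))"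
      by (simp add: iota_Suc_cell[OF c] inf_sup_distrib1)
    ultimately have "oplus M (\<phi> (inf p (\<iota> (c k)))) (\<phi> (inf p (cell \<iota> c k))) = Some (\<phi> (inf p (\<iota> (c (Suc k)))))"
      using phi_additive by metis
    moreover have "inf p (cell \<iota> c k) = (if k \<in> S then cell \<iota> c k else bot)"
      using p k by (auto simp: selects_def inf.absorb2 inf_commute)
    ultimately show ?thesis using phi_cell[OF c] phi_bot by (cases "k \<in> S") auto
  qed
  have whole: "inf p (\<iota> (c 0)) = bot" "inf p (\<iota> (c n)) = p" if "selects c n S p" for c p
  proof -
    have "p \<le> \<iota> (c n)" "p \<le> - \<iota> (c 0)" using that by (auto simp: selects_def diff_eq)
    then show "inf p (\<iota> (c 0)) = bot" "inf p (\<iota> (c n)) = p" by (simp_all add: inf_shunt inf.absorb1)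
  qed
  have "\<phi> (inf p (\<iota> (c k))) = \<phi> (inf q (\<iota> (e k)))" if "k \<le> n" for k
    using that
  proof (induction k)
    case 0
    then show ?case using whole(1)[OF p] whole(1)[OF q] by simp
  next
    case (Suc k)
    then show ?case using step[OF c p, of k] step[OF e q, of k] eq[of k] by (cases "k \<in> S") auto
  qed
  from this[of n] show ?thesis using whole(2)[OF p] whole(2)[OF q] by simp
qed

lemma corr_phi:
  assumes e: "equidistant x y x' y'" and "corr x y x' p q"
  shows "\<phi> p = \<phi> q"
proof -
  obtain c n S where c: "chain c n x y" "selects c n S p" "selects (shift x x' \<circ> c) n S q"
    using assms(2) by (auto simp: corr_def)
  show ?thesis
    using phi_selects[OF c(1,2) chain_shift[OF e c(1)] c(3)]
      shift_mono(2)[OF e chain_between(3)[OF c(1)] chainD(2)[OF c(1)] chain_between(4)[OF c(1)]] by simp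
qed

text \<open>An order isomorphism is enough, as the order determines the Boolean operations. Values
  of \<open>f\<close> outside the ideal are irrelevant.\<close>

definition phi_iso :: "('b \<Rightarrow> 'b) \<Rightarrow> 'b \<Rightarrow> 'b \<Rightarrow> bool" where
  "phi_iso f a b \<longleftrightarrow> bij_betw f {..a} {..b} \<and>
     (\<forall>p\<le>a. \<forall>q\<le>a. f p \<le> f q \<longleftrightarrow> p \<le> q) \<and> (\<forall>p\<le>a. \<phi> (f p) = \<phi> p)"

lemma corr_bound: "equidistant x y x' y' \<Longrightarrow> corr x y x' p q \<Longrightarrow> q \<le> \<iota> y' - \<iota> x'"
  using chain_shift chainD(3,4) unfolding corr_def selects_def by metis

text \<open>Choose \<open>f\<close> from the total relation \<open>corr\<close>; surjectivity is
  totality for the opposite translation together with single-valuedness.\<close>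

lemma phi_iso_of_equidistant:
  assumes e: "equidistant x y x' y'"
  shows "\<exists>f. phi_iso f (\<iota> y - \<iota> x) (\<iota> y' - \<iota> x')"
proof -
  have "\<forall>p. \<exists>q. p \<le> \<iota> y - \<iota> x \<longrightarrow> corr x y x' p q" using corr_total[OF e] by blast
  then obtain f where f: "\<And>p. p \<le> \<iota> y - \<iota> x \<Longrightarrow> corr x y x' p (f p)" by metis
  have le: "f p \<le> f q \<longleftrightarrow> p \<le> q" if "p \<le> \<iota> y - \<iota> x" "q \<le> \<iota> y - \<iota> x" for p q
    using corr_le_iff[OF e f f] that by blast
  have "bij_betw f {..\<iota> y - \<iota> x} {..\<iota> y' - \<iota> x'}"
    unfolding bij_betw_def
  proof
    show "inj_on f {..\<iota> y - \<iota> x}"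
    proof (rule inj_onI)
      fix p q assume "p \<in> {..\<iota> y - \<iota> x}" "q \<in> {..\<iota> y - \<iota> x}" "f p = f q"
      then show "p = q" using le[of p q] le[of q p] by simp
    qed
    show "f ` {..\<iota> y - \<iota> x} = {..\<iota> y' - \<iota> x'}"
    proof
      show "f ` {..\<iota> y - \<iota> x} \<subseteq> {..\<iota> y' - \<iota> x'}" using f corr_bound[OF e] by auto
      show "{..\<iota> y' - \<iota> x'} \<subseteq> f ` {..\<iota> y - \<iota> x}"
      proof
        fix q assume "q \<in> {..\<iota> y' - \<iota> x'}"
        then obtain p where "corr x' y' x q p" using corr_total[OF equidistant_sym[OF e]] by auto
        then have p: "corr x y x' p q" "p \<le> \<iota> y - \<iota> x"
          using corr_sym[OF equidistant_sym[OF e]] corr_bound[OF equidistant_sym[OF e]] by auto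
        then have "q = f p" using corr_le_iff[OF e p(1) f] corr_le_iff[OF e f p(1)] by (meson order_antisym order_refl)
        then show "q \<in> f ` {..\<iota> y - \<iota> x}" using p(2) by blast
      qed
    qed
  qed
  then show ?thesis using le corr_phi[OF e f] by (auto simp: phi_iso_def)
qed

end

section \<open>Transport of structure\<close>

text \<open>Hypothesis \<open>sum\<close> also transfers undefinedness, so every axiom can be pulled
  back along \<open>\<chi>\<close>. It is meant for the quotient as \<open>Q\<close> and the fibre
  map as \<open>\<chi>\<close>.\<close>

lemma effect_algebra_transport:
  assumes E: "effect_algebra E" and bij: "bij_betw \<chi> (carrier E) (carrier Q)"
    and zero: "ezero Q = \<chi> (ezero E)" and one: "eone Q = \<chi> (eone E)"
    and sum: "\<And>a b. a \<in> carrier E \<Longrightarrow> b \<in> carrier E \<Longrightarrow>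
      oplus Q (\<chi> a) (\<chi> b) = map_option \<chi> (oplus E a b)"
  shows "effect_algebra Q"
proof -
  interpret E: effect_algebra E by (rule E)
  have im: "carrier Q = \<chi> ` carrier E" using bij by (simp add: bij_betw_def)
  have inj: "\<chi> a = \<chi> b \<longleftrightarrow> a = b" if "a \<in> carrier E" "b \<in> carrier E" for a b
    using bij that by (auto simp: bij_betw_def inj_on_def)
  have sumD: "\<exists>c. oplus E a b = Some c \<and> Z = \<chi> c \<and> c \<in> carrier E"
    if "a \<in> carrier E" "b \<in> carrier E" "oplus Q (\<chi> a) (\<chi> b) = Some Z" for a b Z
    using that(3) sum[OF that(1,2)] E.oplus_closed[OF that(1,2)] by auto
  show ?thesis
  proof
    show "ezero Q \<in> carrier Q" "eone Q \<in> carrier Q"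
      using zero one im E.ezero_closed E.eone_closed by auto
  next
    fix X Y Z assume *: "X \<in> carrier Q" "Y \<in> carrier Q" "oplus Q X Y = Some Z"
    then obtain a b where ab: "a \<in> carrier E" "b \<in> carrier E" "X = \<chi> a" "Y = \<chi> b" using im by auto
    then obtain c where c: "oplus E a b = Some c" "Z = \<chi> c" "c \<in> carrier E" using sumD * by blast
    show "Z \<in> carrier Q" using c im by blast
    show "oplus Q Y X = Some Z" using E.E1[OF ab(1,2) c(1)] sum[OF ab(2,1)] ab c by simp
  next
    fix X Y Z S T
    assume *: "X \<in> carrier Q" "Y \<in> carrier Q" "Z \<in> carrier Q"
      "oplus Q X Y = Some S" "oplus Q S Z = Some T"
    then obtain a b c where abc: "a \<in> carrier E" "b \<in> carrier E" "c \<in> carrier E"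
      "X = \<chi> a" "Y = \<chi> b" "Z = \<chi> c" using im by auto
    obtain s where s: "oplus E a b = Some s" "S = \<chi> s" "s \<in> carrier E"
      using sumD[OF abc(1,2)] * abc by blast
    obtain t where t: "oplus E s c = Some t" "T = \<chi> t"
      using sumD[OF s(3) abc(3)] * abc s by blast
    obtain u where u: "oplus E b c = Some u" "oplus E a u = Some t" using E.E2[OF abc(1-3) s(1) t(1)] by blast
    have "u \<in> carrier E" using E.oplus_closed[OF abc(2,3) u(1)] .
    then show "\<exists>U. oplus Q Y Z = Some U \<and> oplus Q X U = Some T"
      using sum[OF abc(2,3)] sum[OF abc(1)] u abc t by auto
  next
    fix X assume "X \<in> carrier Q"
    then obtain a where a: "a \<in> carrier E" "X = \<chi> a" using im by auto
    have "oplus Q X (\<chi> b) = Some (eone Q) \<longleftrightarrow> oplus E a b = Some (eone E)" if b: "b \<in> carrier E" for b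
      using sum[OF a(1) b] a inj E.oplus_closed[OF a(1) b] E.eone_closed one by auto
    moreover obtain b where b: "b \<in> carrier E" "oplus E a b = Some (eone E)"
      and uniq: "\<And>c. c \<in> carrier E \<Longrightarrow> oplus E a c = Some (eone E) \<Longrightarrow> c = b"
      using E.E3[OF a(1)] by blast
    ultimately have "X' \<in> carrier Q \<and> oplus Q X X' = Some (eone Q) \<longleftrightarrow> X' = \<chi> b" for X'
      unfolding im by blast
    then show "\<exists>!X'. X' \<in> carrier Q \<and> oplus Q X X' = Some (eone Q)" by simp
  next
    fix X assume "X \<in> carrier Q" and o: "eff_orth Q X (eone Q)"
    then obtain a where a: "a \<in> carrier E" "X = \<chi> a" using im by auto
    then have "eff_orth E a (eone E)"
      using o sum[OF a(1) E.eone_closed] one by (auto simp: eff_orth_def)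
    then show "X = ezero Q" using E.E4[OF a(1)] a zero by simp
  qed
qed

text \<open>The order is defined from sums, so \<open>\<chi>\<close> preserves and reflects it;
  joins, meets and differences follow by uniqueness.\<close>

lemma mv_effect_algebra_transport:
  assumes E: "mv_effect_algebra E" and bij: "bij_betw \<chi> (carrier E) (carrier Q)"
    and zero: "ezero Q = \<chi> (ezero E)" and one: "eone Q = \<chi> (eone E)"
    and sum: "\<And>a b. a \<in> carrier E \<Longrightarrow> b \<in> carrier E \<Longrightarrow>
      oplus Q (\<chi> a) (\<chi> b) = map_option \<chi> (oplus E a b)"
  shows "mv_effect_algebra Q"
proof -
  interpret E: mv_effect_algebra E by (rule E)
  interpret Q: effect_algebra Q
    using effect_algebra_transport[OF E.effect_algebra_axioms bij zero one sum] .
  have im: "carrier Q = \<chi> ` carrier E" using bij by (simp add: bij_betw_def)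
  have inj: "\<chi> a = \<chi> b \<longleftrightarrow> a = b" if "a \<in> carrier E" "b \<in> carrier E" for a b
    using bij that by (auto simp: bij_betw_def inj_on_def)
  interpret L: lattice "eff_order E" by (rule E.eff_lattice)
  have le: "eff_le Q (\<chi> a) (\<chi> b) \<longleftrightarrow> eff_le E a b" if ab: "a \<in> carrier E" "b \<in> carrier E" for a b
  proof
    assume "eff_le Q (\<chi> a) (\<chi> b)"
    then obtain c where c: "c \<in> carrier E" "oplus Q (\<chi> a) (\<chi> c) = Some (\<chi> b)"
      using im by (auto simp: eff_le_def)
    then obtain d where d: "oplus E a c = Some d" "\<chi> d = \<chi> b" using sum[OF ab(1)] by auto
    then have "d = b" using inj[of d b] E.oplus_closed[OF ab(1) c(1)] ab by simp
    then show "eff_le E a b" using c d by (auto simp: eff_le_def)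
  next
    assume "eff_le E a b"
    then obtain c where c: "c \<in> carrier E" "oplus E a c = Some b" by (auto simp: eff_le_def)
    then show "eff_le Q (\<chi> a) (\<chi> b)" using sum[OF ab(1) c(1)] im by (auto simp: eff_le_def)
  qed
  interpret P: partial_order "eff_order Q"
    by standard (auto intro: Q.eff_le_refl Q.eff_le_antisym Q.eff_le_trans)
  have join: "least (eff_order Q) (\<chi> (a \<squnion>\<^bsub>eff_order E\<^esub> b)) (Upper (eff_order Q) {\<chi> a, \<chi> b})"
    and meet: "greatest (eff_order Q) (\<chi> (a \<sqinter>\<^bsub>eff_order E\<^esub> b)) (Lower (eff_order Q) {\<chi> a, \<chi> b})"
    if ab: "a \<in> carrier E" "b \<in> carrier E" for a b
  proof -
    have C: "a \<squnion>\<^bsub>eff_order E\<^esub> b \<in> carrier E" "a \<sqinter>\<^bsub>eff_order E\<^esub> b \<in> carrier E"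
      using L.join_closed L.meet_closed ab by auto
    show "least (eff_order Q) (\<chi> (a \<squnion>\<^bsub>eff_order E\<^esub> b)) (Upper (eff_order Q) {\<chi> a, \<chi> b})"
      using C ab im le L.join_left[of a b] L.join_right[of a b] L.join_le[of a _ b]
      by (intro least_UpperI) (auto simp: Upper_def)
    show "greatest (eff_order Q) (\<chi> (a \<sqinter>\<^bsub>eff_order E\<^esub> b)) (Lower (eff_order Q) {\<chi> a, \<chi> b})"
      using C ab im le L.meet_left[of a b] L.meet_right[of a b] L.meet_le[of _ a b]
      by (intro greatest_LowerI) (auto simp: Lower_def)
  qed
  interpret QL: lattice "eff_order Q"
  proof
    fix X Y assume "X \<in> carrier (eff_order Q)" "Y \<in> carrier (eff_order Q)"
    then obtain a b where "a \<in> carrier E" "b \<in> carrier E" "X = \<chi> a" "Y = \<chi> b" using im by auto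
    then show "\<exists>s. least (eff_order Q) s (Upper (eff_order Q) {X, Y})"
      "\<exists>s. greatest (eff_order Q) s (Lower (eff_order Q) {X, Y})" using join meet by blast+
  qed
  have minus: "ominus Q (\<chi> b) (\<chi> a) = \<chi> (ominus E b a)"
    if ab: "a \<in> carrier E" "eff_le E a b" for a b
    using E.oplus_ominus[OF ab] sum[OF ab(1), of "ominus E b a"] im ab
    by (intro Q.ominus_eqI) auto
  show ?thesis
  proof
    fix X Y assume XY: "X \<in> carrier Q" "Y \<in> carrier Q"
    then obtain a b where ab: "a \<in> carrier E" "b \<in> carrier E" "X = \<chi> a" "Y = \<chi> b" using im by auto
    have j: "X \<squnion>\<^bsub>eff_order Q\<^esub> Y = \<chi> (a \<squnion>\<^bsub>eff_order E\<^esub> b)"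
      using join[OF ab(1,2)] P.least_unique QL.joinI[of X Y "\<lambda>l. l = \<chi> (a \<squnion>\<^bsub>eff_order E\<^esub> b)"] XY ab(3,4)
      by simp
    have m: "X \<sqinter>\<^bsub>eff_order Q\<^esub> Y = \<chi> (a \<sqinter>\<^bsub>eff_order E\<^esub> b)"
      using meet[OF ab(1,2)] P.greatest_unique QL.meetI[of X Y "\<lambda>l. l = \<chi> (a \<sqinter>\<^bsub>eff_order E\<^esub> b)"] XY ab(3,4)
      by simp
    have "a \<sqinter>\<^bsub>eff_order E\<^esub> b \<in> carrier E" "eff_le E a (a \<squnion>\<^bsub>eff_order E\<^esub> b)"
      "eff_le E (a \<sqinter>\<^bsub>eff_order E\<^esub> b) b"
      using L.join_left[of a b] L.meet_right[of a b] L.meet_closed[of a b] ab by auto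
    then show "ominus Q (X \<squnion>\<^bsub>eff_order Q\<^esub> Y) X = ominus Q Y (X \<sqinter>\<^bsub>eff_order Q\<^esub> Y)"
      unfolding j m using minus ab E.mv by simp
  qed
qed

lemma eff_iso_transport:
  assumes E: "effect_algebra E" and bij: "bij_betw \<chi> (carrier E) (carrier Q)"
    and zero: "ezero Q = \<chi> (ezero E)" and one: "eone Q = \<chi> (eone E)"
    and sum: "\<And>a b. a \<in> carrier E \<Longrightarrow> b \<in> carrier E \<Longrightarrow>
      oplus Q (\<chi> a) (\<chi> b) = map_option \<chi> (oplus E a b)"
  shows "eff_iso Q E (inv_into (carrier E) \<chi>)"
proof -
  interpret E: effect_algebra E by (rule E)
  let ?f = "inv_into (carrier E) \<chi>"
  have im: "carrier Q = \<chi> ` carrier E" using bij by (simp add: bij_betw_def)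
  have f: "?f (\<chi> a) = a" if "a \<in> carrier E" for a
    using bij that by (simp add: bij_betw_def)
  have Q: "effect_algebra Q" by (rule effect_algebra_transport[OF E bij zero one sum])
  have bij': "bij_betw ?f (carrier Q) (carrier E)" using bij_betw_inv_into[OF bij] .
  have "eff_morphism Q E ?f"
    unfolding eff_morphism_def
  proof (intro conjI ballI allI impI)
    show "effect_algebra Q" "effect_algebra E" by (fact Q) (fact E)
    show "?f \<in> carrier Q \<rightarrow> carrier E" using bij' by (auto simp: bij_betw_def)
    show "?f (eone Q) = eone E" using one f E.eone_closed by simp
    fix X Y Z assume *: "X \<in> carrier Q" "Y \<in> carrier Q" "oplus Q X Y = Some Z"
    then obtain a b where ab: "a \<in> carrier E" "b \<in> carrier E" "X = \<chi> a" "Y = \<chi> b" using im by auto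
    then show "oplus E (?f X) (?f Y) = Some (?f Z)"
      using * sum[OF ab(1,2)] E.oplus_closed[OF ab(1,2)] f by auto
  qed
  \<comment> \<open>Fullness holds with \<open>X\<close> and \<open>Y\<close> themselves, because
    definedness of sums transfers back.\<close>
  moreover have "\<exists>a1\<in>carrier Q. \<exists>b1\<in>carrier Q. ?f X = ?f a1 \<and> ?f Y = ?f b1 \<and> eff_orth Q a1 b1"
    if *: "X \<in> carrier Q" "Y \<in> carrier Q" "oplus E (?f X) (?f Y) = Some s" for X Y s
  proof -
    obtain a b where ab: "a \<in> carrier E" "b \<in> carrier E" "X = \<chi> a" "Y = \<chi> b" using * im by auto
    then have "eff_orth Q X Y" using *(3) sum[OF ab(1,2)] f by (simp add: eff_orth_def)
    then show ?thesis using * by blast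
  qed
  ultimately show ?thesis using bij' by (auto simp: eff_iso_def full_morphism_def)
qed

lemma group_Aut: "group Aut"
proof (rule groupI)
  fix f :: "'b::boolean_algebra \<Rightarrow> 'b" assume "f \<in> carrier Aut"
  then have f: "bij f" "\<And>x y. f (inf x y) = inf (f x) (f y)" "\<And>x y. f (sup x y) = sup (f x) (f y)"
    "\<And>x. f (- x) = - f x" by (auto simp: Aut_def boolean_aut_def)
  have ff: "f (inv_into UNIV f x) = x" for x using f(1) by (simp add: bij_is_surj surj_f_inv_f)
  have eqI: "f a = f b \<Longrightarrow> a = b" for a b using f(1) by (simp add: bij_is_inj inj_eq)
  have "inv_into UNIV f \<in> boolean_aut"
    unfolding boolean_aut_def
  proof (intro CollectI conjI allI)
    show "bij (inv_into UNIV f)" using f(1) by (rule bij_imp_bij_inv)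
  qed (rule eqI; simp add: ff f)+
  moreover have "inv_into UNIV f \<circ> f = id" using f(1) by (simp add: bij_is_inj)
  ultimately show "\<exists>y\<in>carrier Aut. y \<otimes>\<^bsub>Aut\<^esub> f = \<one>\<^bsub>Aut\<^esub>" by (auto simp: Aut_def)
qed (auto simp: Aut_def boolean_aut_def bij_comp comp_assoc)

section \<open>Isomorphisms of principal ideals and orbits\<close>

context mv_boolean
begin

section \<open>Composing and gluing isomorphisms of ideals\<close>

lemma phi_isoD:
  assumes "phi_iso f a b"
  shows "p \<le> a \<Longrightarrow> f p \<le> b" and "p \<le> a \<Longrightarrow> q \<le> a \<Longrightarrow> f p \<le> f q \<longleftrightarrow> p \<le> q"
    and "p \<le> a \<Longrightarrow> \<phi> (f p) = \<phi> p" and "r \<le> b \<Longrightarrow> \<exists>p\<le>a. f p = r"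
proof -
  have im: "f ` {..a} = {..b}" using assms by (simp add: phi_iso_def bij_betw_def)
  then show "p \<le> a \<Longrightarrow> f p \<le> b" by blast
  have "r \<in> f ` {..a}" if "r \<le> b" using im that by simp
  then show "r \<le> b \<Longrightarrow> \<exists>p\<le>a. f p = r" by auto
qed (use assms in \<open>auto simp: phi_iso_def\<close>)

lemma phi_isoI:
  assumes "\<And>p. p \<le> a \<Longrightarrow> f p \<le> b" and "\<And>p q. p \<le> a \<Longrightarrow> q \<le> a \<Longrightarrow> f p \<le> f q \<longleftrightarrow> p \<le> q"
    and "\<And>p. p \<le> a \<Longrightarrow> \<phi> (f p) = \<phi> p" and "\<And>r. r \<le> b \<Longrightarrow> \<exists>p\<le>a. f p = r"
  shows "phi_iso f a b"
proof -
  have "inj_on f {..a}"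
  proof (rule inj_onI)
    fix p q assume "p \<in> {..a}" "q \<in> {..a}" "f p = f q"
    then show "p = q" using assms(2)[of p q] assms(2)[of q p] by simp
  qed
  moreover have "f ` {..a} = {..b}" using assms(1,4) by fastforce
  ultimately show ?thesis using assms(2,3) by (auto simp: phi_iso_def bij_betw_def)
qed

lemma phi_iso_top:
  assumes "phi_iso f a b"
  shows "f a = b"
proof -
  obtain p where "p \<le> a" "f p = b" using phi_isoD(4)[OF assms] by blast
  then show ?thesis using phi_isoD(1,2)[OF assms] by (metis order_antisym order_refl)
qed

lemma phi_iso_bot:
  assumes "phi_iso f a b"
  shows "f bot = bot"
proof -
  obtain p where "p \<le> a" "f p = bot" using phi_isoD(4)[OF assms bot_least] by blast
  then show ?thesis using phi_isoD(2)[OF assms, of bot p] by (simp add: bot_unique)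
qed

lemma phi_iso_id: "phi_iso id a a"
  by (rule phi_isoI) auto

lemma phi_iso_sym:
  assumes "phi_iso f a b"
  shows "\<exists>g. phi_iso g b a"
proof -
  note D = phi_isoD[OF assms]
  obtain g where g: "\<And>r. r \<le> b \<Longrightarrow> g r \<le> a \<and> f (g r) = r" using D(4) by metis
  have "phi_iso g b a"
  proof (rule phi_isoI)
    fix p assume "p \<le> b" then show "g p \<le> a" "\<phi> (g p) = \<phi> p" using g D(3) by metis+
  next
    fix p q assume "p \<le> b" "q \<le> b" then show "g p \<le> g q \<longleftrightarrow> p \<le> q" using g D(2) by metis
  next
    fix p assume p: "p \<le> a"
    then have "f (g (f p)) = f p" "g (f p) \<le> a" using g D(1) by auto
    then have "g (f p) = p" using D(2) p by (metis order_antisym order_refl)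
    then show "\<exists>r\<le>b. g r = p" using D(1) p by blast
  qed
  then show ?thesis by blast
qed

lemma phi_iso_trans:
  assumes f: "phi_iso f a b" and g: "phi_iso g b c"
  shows "phi_iso (g \<circ> f) a c"
proof (rule phi_isoI)
  fix r assume "r \<le> c"
  then show "\<exists>p\<le>a. (g \<circ> f) p = r" using phi_isoD(4)[OF f] phi_isoD(4)[OF g] by (metis comp_apply)
qed (use phi_isoD(1-3)[OF f] phi_isoD(1-3)[OF g] in auto)

text \<open>Here \<open>f\<close> acts on the part of \<open>p\<close> below \<open>a\<close>,
  \<open>g\<close> on the part below \<open>a'\<close>. As \<open>b\<close> and \<open>b'\<close>
  are disjoint, meeting the image with them recovers both parts, and the values add by
  \<open>phi_additive\<close>.\<close>

lemma phi_iso_sup: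
  assumes f: "phi_iso f a b" and g: "phi_iso g a' b'"
    and dis: "inf a a' = bot" "inf b b' = bot"
  shows "phi_iso (\<lambda>p. sup (f (inf p a)) (g (inf p a'))) (sup a a') (sup b b')"
proof -
  note F = phi_isoD[OF f] and G = phi_isoD[OF g]
  let ?h = "\<lambda>p. sup (f (inf p a)) (g (inf p a'))"
  have dec: "p = sup (inf p a) (inf p a')" if "p \<le> sup a a'" for p a a' :: 'b
    using that by (simp add: inf_sup_distrib1[symmetric] inf.absorb1)
  have sub: "inf (sup x y) b = x" "inf (sup x y) b' = y"
    if "inf b b' = bot" "x \<le> b" "y \<le> b'" for x y b b' :: 'b
  proof -
    have "inf y b \<le> inf b' b" "inf x b' \<le> inf b b'"
      using that(2,3) by (simp_all add: inf.coboundedI1 inf.coboundedI2)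
    then have "inf y b = bot" "inf x b' = bot" using that(1)
      by (metis inf_commute bot_unique)+
    then show "inf (sup x y) b = x" "inf (sup x y) b' = y"
      using that by (simp_all add: inf_sup_distrib2 inf.absorb1)
  qed
  have hb: "inf (?h p) b = f (inf p a)" "inf (?h p) b' = g (inf p a')" for p
    using sub[OF dis(2)] F(1) G(1) by simp_all
  show ?thesis
  proof (rule phi_isoI)
    show "?h p \<le> sup b b'" for p using F(1) G(1) by (intro sup_mono) auto
  next
    fix p q assume pq: "p \<le> sup a a'" "q \<le> sup a a'"
    show "?h p \<le> ?h q \<longleftrightarrow> p \<le> q"
    proof
      assume "?h p \<le> ?h q"
      then have "inf (?h p) b \<le> inf (?h q) b" "inf (?h p) b' \<le> inf (?h q) b'"
        by (intro inf_mono order_refl; assumption)+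
      then have "inf p a \<le> inf q a" "inf p a' \<le> inf q a'"
        unfolding hb using F(2) G(2) by auto
      then show "p \<le> q" using dec[OF pq(1)] dec[OF pq(2)] by (metis sup_mono)
    next
      assume "p \<le> q"
      then have "inf p a \<le> inf q a" "inf p a' \<le> inf q a'" by (simp_all add: inf.coboundedI1)
      then show "?h p \<le> ?h q" using F(2) G(2) by (intro sup_mono) auto
    qed
  next
    fix p assume p: "p \<le> sup a a'"
    have "inf (f (inf p a)) (g (inf p a')) \<le> inf b b'" using F(1) G(1) by (intro inf_mono) auto
    then have "inf (f (inf p a)) (g (inf p a')) = bot" using dis by (simp add: bot_unique)
    from phi_additive[OF this]
    have "oplus M (\<phi> (inf p a)) (\<phi> (inf p a')) = Some (\<phi> (?h p))" using F(3) G(3) by simp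
    moreover have "inf (inf p a) (inf p a') = bot"
      using dis by (metis inf_assoc inf_commute inf_bot_right)
    ultimately have "\<phi> (?h p) = \<phi> (sup (inf p a) (inf p a'))" using phi_additive by simp
    then show "\<phi> (?h p) = \<phi> p" using dec[OF p] by simp
  next
    fix r assume r: "r \<le> sup b b'"
    obtain p p' where p: "p \<le> a" "f p = inf r b" "p' \<le> a'" "g p' = inf r b'"
      using F(4) G(4) by (metis inf_le2)
    then have "?h (sup p p') = r" using sub[OF dis(1) p(1,3)] dec[OF r] by simp
    then show "\<exists>p\<le>sup a a'. ?h p = r" using sup_mono[OF p(1,3)] by (intro exI[of _ "sup p p'"] conjI)
  qed
qed

lemma phi_iso_iota_phi: "\<exists>f. phi_iso f b (\<iota> (\<phi> b))"
proof -
  obtain c n where c: "chain c n (ezero M) (eone M)" and s: "splits c n b"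
    using common_splitting by blast
  have "\<exists>f. phi_iso f (inf b (\<iota> (c k))) (\<iota> (\<phi> (inf b (\<iota> (c k)))))" if "k \<le> n" for k
    using that
  proof (induction k)
    case 0
    then show ?case using chainD(3)[OF c] phi_bot phi_iso_id by auto
  next
    case (Suc k)
    let ?p = "inf b (\<iota> (c k))" and ?q = "inf b (\<iota> (c (Suc k)))"
    obtain f where f: "phi_iso f ?p (\<iota> (\<phi> ?p))" using Suc by auto
    have q: "?q = sup ?p (inf b (cell \<iota> c k))"
      by (simp add: iota_Suc_cell[OF c] inf_sup_distrib1)
    show ?case
    proof (cases "cell \<iota> c k \<le> b")
      case False
      then have "inf b (cell \<iota> c k) = bot" using s Suc.prems
        by (metis splits_def Suc_le_lessD inf_commute)
      then show ?thesis using f q by auto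
    next
      case True
      then have q: "?q = sup ?p (cell \<iota> c k)" using q by (simp add: inf.absorb2)
      have dis: "inf ?p (cell \<iota> c k) = bot" by (simp add: cell_def diff_eq ac_simps)
      have sum: "oplus M (\<phi> ?p) (c (Suc k) \<ominus> c k) = Some (\<phi> ?q)"
        using phi_additive[OF dis] q phi_cell[OF c] by simp
      have d: "c (Suc k) \<ominus> c k \<in> C" using oplus_ominus(1) chainD(1,2)[OF c] by blast
      have le: "\<phi> ?p \<preceq> \<phi> ?q" using sum d by (auto simp: eff_le_def)
      \<comment> \<open>The new cell is translated to the interval directly above
        \<open>\<phi> ?p\<close>, the height of the stack so far.\<close>
      have "equidistant (c k) (c (Suc k)) (\<phi> ?p) (\<phi> ?q)"
        using chainD(1,2)[OF c] phi_closed le ominus_eqI[OF phi_closed d sum]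
        by (simp add: equidistant_def)
      then obtain g where g: "phi_iso g (cell \<iota> c k) (\<iota> (\<phi> ?q) - \<iota> (\<phi> ?p))"
        using phi_iso_of_equidistant unfolding cell_def by blast
      have m: "\<iota> (\<phi> ?p) \<le> \<iota> (\<phi> ?q)" using le eff_le_iff_iota phi_closed by blast
      have "inf (\<iota> (\<phi> ?p)) (\<iota> (\<phi> ?q) - \<iota> (\<phi> ?p)) = bot"
        by (simp add: diff_eq inf_left_commute)
      moreover have "sup (\<iota> (\<phi> ?p)) (\<iota> (\<phi> ?q) - \<iota> (\<phi> ?p)) = \<iota> (\<phi> ?q)"
        using m by (simp add: diff_eq sup_inf_distrib1 sup.absorb2)
      ultimately show ?thesis using phi_iso_sup[OF f g dis] q by auto
    qed
  qed
  from this[of n] show ?thesis using chainD(4)[OF c] by simp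
qed

section \<open>Automorphisms in \<open>G_M\<close> and their orbits\<close>

lemma phi_iso_exists: "\<phi> a = \<phi> b \<Longrightarrow> \<exists>f. phi_iso f a b"
  using phi_iso_iota_phi[of a] phi_iso_iota_phi[of b] phi_iso_sym phi_iso_trans by metis

text \<open>Such a \<open>b\<close> has the value of \<open>bot\<close>, so its ideal is isomorphic
  to a one-element ideal.\<close>

lemma phi_eq_zero: "\<phi> b = ezero M \<Longrightarrow> b = bot"
proof -
  assume "\<phi> b = ezero M"
  then obtain f where f: "phi_iso f b bot" using phi_iso_exists[of b bot] phi_bot by auto
  have "f b \<le> f bot" using phi_iso_top[OF f] by simp
  then show "b = bot" using phi_isoD(2)[OF f, of b bot] by (simp add: bot_unique)
qed

text \<open>A surjective order embedding preserves meets, joins and both bounds, hence complements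
  by their uniqueness.\<close>

lemma phi_iso_in_G_M:
  assumes f: "phi_iso f top top"
  shows "f \<in> G_M M \<iota>"
proof -
  have le: "f p \<le> f q \<longleftrightarrow> p \<le> q" for p q using phi_isoD(2)[OF f] by simp
  have surj: "\<exists>p. f p = r" for r using phi_isoD(4)[OF f] by fastforce
  have "bij f"
  proof (rule bijI)
    show "inj f" by (rule injI) (metis le order_antisym order_refl)
    show "surj f" using surj by (metis surjI)
  qed
  moreover have inf: "f (inf x y) = inf (f x) (f y)" for x y
  proof -
    obtain z where z: "f z = inf (f x) (f y)" using surj by blast
    then have "z \<le> inf x y" using le[of z x] le[of z y] by simp
    then have "inf (f x) (f y) \<le> f (inf x y)" using le z by metis
    then show ?thesis using le by (simp add: order_antisym)
  qed
  moreover have sup: "f (sup x y) = sup (f x) (f y)" for x y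
  proof -
    obtain z where z: "f z = sup (f x) (f y)" using surj by blast
    then have "sup x y \<le> z" using le[of x z] le[of y z] by simp
    then have "f (sup x y) \<le> sup (f x) (f y)" using le z by metis
    then show ?thesis using le by (simp add: order_antisym)
  qed
  moreover have "f (- x) = - f x" for x
  proof -
    have "inf (f x) (f (- x)) = bot" "sup (f x) (f (- x)) = top"
      using phi_iso_bot[OF f] phi_iso_top[OF f] by (simp_all flip: inf sup)
    then show ?thesis by (rule compl_unique[symmetric])
  qed
  ultimately show ?thesis
    using phi_isoD(3)[OF f] by (auto simp: G_M_def boolean_aut_def phi_preserving_def)
qed

text \<open>The complements of the two joins also have equal values, which gives a third
  isomorphism; the three glue to an automorphism. Two pairs at once allow MVP1 to move a part of
  \<open>b\<close> and the rest of \<open>b\<close> together.\<close>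

lemma extend_disjoint:
  assumes "\<phi> a = \<phi> b" "\<phi> a' = \<phi> b'" and dis: "inf a a' = bot" "inf b b' = bot"
  shows "\<exists>f\<in>G_M M \<iota>. f a = b \<and> f a' = b'"
proof -
  obtain f g where f: "phi_iso f a b" and g: "phi_iso g a' b'" using phi_iso_exists assms by meson
  let ?a = "sup a a'" and ?b = "sup b b'"
  have "\<phi> ?a = \<phi> ?b" using phi_additive[OF dis(1)] phi_additive[OF dis(2)] assms by simp
  then have "\<phi> (top - ?a) = \<phi> (top - ?b)" by (simp add: phi_diff)
  then obtain h where h: "phi_iso h (- ?a) (- ?b)" using phi_iso_exists by (metis diff_eq inf_top_left)
  let ?k = "\<lambda>p. sup (f (inf p a)) (g (inf p a'))"
  let ?l = "\<lambda>p. sup (?k (inf p ?a)) (h (inf p (- ?a)))"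
  note k = phi_iso_sup[OF f g dis]
  have "phi_iso ?l (sup ?a (- ?a)) (sup ?b (- ?b))"
    by (rule phi_iso_sup[OF k h]) (simp_all only: inf_compl_bot)
  then have l: "?l \<in> G_M M \<iota>" using phi_iso_in_G_M by (simp only: sup_compl_top)
  have lk: "?l p = ?k p" if "p \<le> ?a" for p
  proof -
    have "inf p (- ?a) = bot" "inf p ?a = p"
      using that by (simp_all only: inf_shunt double_compl inf.absorb1)
    then show ?thesis using phi_iso_bot[OF h] by simp
  qed
  have la: "?l a = b"
    unfolding lk[OF sup_ge1] using phi_iso_top[OF f] phi_iso_bot[OF g] dis by simp
  have la': "?l a' = b'"
    unfolding lk[OF sup_ge2] using phi_iso_top[OF g] phi_iso_bot[OF f] dis by (simp add: inf_commute)
  show ?thesis by (rule bexI[of _ ?l], rule conjI) (fact la la' l)+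
qed

lemma G_M_D:
  assumes "f \<in> G_M M \<iota>"
  shows "\<phi> (f x) = \<phi> x" and "f (inf x y) = inf (f x) (f y)" and "f (sup x y) = sup (f x) (f y)"
    and "f (- x) = - f x" and "bij f"
  using assms by (auto simp: G_M_def boolean_aut_def phi_preserving_def)

lemma phi_eq_iff_orbit: "\<phi> a = \<phi> b \<longleftrightarrow> (\<exists>f\<in>G_M M \<iota>. f a = b)"
  \<comment> \<open>The second pair is empty.\<close>
  using extend_disjoint[of a b bot bot] G_M_D(1) by auto

lemma orbit_rel_G_M: "orbit_rel (G_M M \<iota>) = {(a, b). \<phi> a = \<phi> b}"
  using phi_eq_iff_orbit by (auto simp: orbit_rel_def)

lemma subgroup_G_M: "subgroup (G_M M \<iota>) Aut"
proof -
  interpret Aut: group "Aut :: ('b \<Rightarrow> 'b) monoid" by (rule group_Aut)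
  show ?thesis
  proof (rule Aut.subgroupI)
    show "G_M M \<iota> \<subseteq> carrier Aut" by (auto simp: G_M_def Aut_def)
    show "G_M M \<iota> \<noteq> {}" using phi_iso_in_G_M[OF phi_iso_id] by blast
    fix f g assume f: "f \<in> G_M M \<iota>" and g: "g \<in> G_M M \<iota>"
    then show "f \<otimes>\<^bsub>Aut\<^esub> g \<in> G_M M \<iota>"
      by (auto simp: Aut_def G_M_def boolean_aut_def phi_preserving_def bij_comp)
  next
    fix f assume f: "f \<in> G_M M \<iota>"
    then have fc: "f \<in> carrier Aut" by (simp add: Aut_def G_M_def)
    then have "inv\<^bsub>Aut\<^esub> f \<in> carrier Aut" "f \<otimes>\<^bsub>Aut\<^esub> inv\<^bsub>Aut\<^esub> f = \<one>\<^bsub>Aut\<^esub>" by simp_all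
    then have a: "inv\<^bsub>Aut\<^esub> f \<in> boolean_aut" "f ((inv\<^bsub>Aut\<^esub> f) x) = x" for x
      by (auto simp: Aut_def fun_eq_iff)
    then have "\<phi> ((inv\<^bsub>Aut\<^esub> f) x) = \<phi> x" for x using G_M_D(1)[OF f] by metis
    then show "inv\<^bsub>Aut\<^esub> f \<in> G_M M \<iota>" using a(1) by (simp add: G_M_def phi_preserving_def)
  qed
qed

text \<open>Below \<open>\<iota> (\<phi> a)\<close> the element \<open>\<iota> m\<close> has value
  \<open>m\<close>; pull it back along the isomorphism from the ideal below
  \<open>a\<close>.\<close>

lemma phi_attains:
  assumes "m \<in> C" "m \<preceq> \<phi> a"
  shows "\<exists>e\<le>a. \<phi> e = m"
proof -
  obtain f where f: "phi_iso f a (\<iota> (\<phi> a))" using phi_iso_iota_phi by blast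
  have "\<iota> m \<le> \<iota> (\<phi> a)" using assms eff_le_iff_iota phi_closed by blast
  then obtain e where "e \<le> a" "f e = \<iota> m" using phi_isoD(4)[OF f] by blast
  then show ?thesis using phi_isoD(3)[OF f] phi_iota assms(1) by metis
qed

lemma phi_compl: "\<phi> (- a) = eone M \<ominus> \<phi> a"
  using phi_diff[of a top] phi_top by (simp add: diff_eq)

text \<open>The maximal elements of \<open>L(a, b)\<close> are its elements of value \<open>\<phi>(a) \<and> \<phi>(b)\<close>. The MV law
  provides the room below \<open>- a\<close> for the part \<open>r\<close> of the image of \<open>b\<close> outside \<open>a\<close>.\<close>

lemma L_set_maximal:
  assumes "x \<in> L_set (G_M M \<iota>) a b"
  shows "\<exists>m\<in>maximal_elements (L_set (G_M M \<iota>) a b). x \<le> m"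
proof -
  obtain f where f: "f \<in> G_M M \<iota>" and x: "x = inf a (f b)" using assms by (auto simp: L_set_def)
  have bound: "\<phi> y \<preceq> \<phi> a \<and> \<phi> y \<preceq> \<phi> b" if "y \<in> L_set (G_M M \<iota>) a b" for y
  proof -
    obtain g where "g \<in> G_M M \<iota>" "y = inf a (g b)" using \<open>y \<in> _\<close> by (auto simp: L_set_def)
    then show ?thesis using phi_mono[of y a] phi_mono[of y "g b"] G_M_D(1) by simp
  qed
  let ?m = "\<phi> a \<curlywedge> \<phi> b"
  have m: "?m \<in> C" "?m \<preceq> \<phi> a" "?m \<preceq> \<phi> b" using meet_closed meet_lower phi_closed by auto
  have xm: "\<phi> x \<preceq> ?m" using bound[OF assms] eff_le_meet_iff phi_closed by simp
  note mx = oplus_ominus[OF phi_closed xm]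
  \<comment> \<open>The value missing to \<open>?m\<close> fits into \<open>a - x\<close>, so
    \<open>x\<close> can be enlarged inside \<open>a\<close> to an element \<open>?c\<close> of
    value \<open>?m\<close>.\<close>
  have "oplus M (?m \<ominus> \<phi> x) (\<phi> a \<ominus> ?m) = Some (\<phi> a \<ominus> \<phi> x)"
    using ominus_oplus_ominus[OF phi_closed xm m(2)] .
  then have "?m \<ominus> \<phi> x \<preceq> \<phi> (a - x)"
    using oplus_ominus(1)[OF m(1,2)] phi_diff[of x a] x by (auto simp: eff_le_def)
  then obtain e where e: "e \<le> a - x" "\<phi> e = ?m \<ominus> \<phi> x" using phi_attains mx(1) by blast
  let ?c = "sup x e"
  have "inf x e \<le> inf x (- x)" using e(1) by (intro inf_mono) (simp_all add: diff_eq)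
  then have "inf x e = bot" by (simp add: bot_unique)
  then have phi_c: "\<phi> ?c = ?m" using phi_additive e(2) mx(2) by fastforce
  have c_le: "?c \<le> a" using x e(1) by (auto simp: diff_eq)
  let ?j = "\<phi> a \<curlyvee> \<phi> b"
  have j: "?j \<in> C" "\<phi> a \<preceq> ?j" using join_closed join_upper phi_closed by auto
  have mv: "\<phi> b \<ominus> ?m = ?j \<ominus> \<phi> a" using mv_law[OF phi_closed phi_closed] by simp
  \<comment> \<open>By \<open>mv\<close>, \<open>\<phi> b \<ominus> ?m\<close> equals
    \<open>?j \<ominus> \<phi> a\<close>, which is at most \<open>\<phi> (- a)\<close>.\<close>
  have "oplus M (?j \<ominus> \<phi> a) (eone M \<ominus> ?j) = Some (eone M \<ominus> \<phi> a)"
    using ominus_oplus_ominus[OF phi_closed j(2)] eff_le_one j(1) by blast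
  then have "\<phi> b \<ominus> ?m \<preceq> \<phi> (- a)"
    using oplus_ominus(1)[OF j(1)] eff_le_one[OF j(1)] unfolding mv phi_compl eff_le_def by blast
  moreover note bm = oplus_ominus[OF m(1,3)]
  ultimately obtain r where r: "r \<le> - a" "\<phi> r = \<phi> b \<ominus> ?m" using phi_attains by blast
  have ar: "inf a r = bot" using r(1) by (metis inf_commute inf_shunt)
  have "inf ?c r \<le> inf a r" using c_le by (intro inf_mono) auto
  then have "inf ?c r = bot" using ar by (simp add: bot_unique)
  \<comment> \<open>With equal values, \<open>b\<close> and \<open>sup ?c r\<close> share an orbit;
    the automorphism \<open>g\<close> taking \<open>b\<close> there realises \<open>?c\<close> as
    \<open>inf a (g b)\<close>.\<close>
  then have "\<phi> (sup ?c r) = \<phi> b" using phi_additive[of ?c r] phi_c r(2) bm(2) by simp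
  then obtain g where g: "g \<in> G_M M \<iota>" "g b = sup ?c r" using phi_eq_iff_orbit[of b "sup ?c r"] by auto
  have "inf a (g b) = ?c" using g(2) ar c_le by (simp add: inf_sup_distrib1 inf.absorb2)
  then have cL: "?c \<in> L_set (G_M M \<iota>) a b" using g(1) unfolding L_set_def by (intro CollectI exI[of _ g]) simp
  have "y = ?c" if y: "y \<in> L_set (G_M M \<iota>) a b" "?c \<le> y" for y
  proof -
    have "\<phi> y \<preceq> ?m" using bound[OF y(1)] eff_le_meet_iff phi_closed by simp
    then have "\<phi> y = \<phi> ?c" using phi_mono[OF y(2)] phi_c eff_le_antisym phi_closed by metis
    then have "\<phi> (y - ?c) = ezero M" using phi_diff[OF y(2)] ominus_self phi_closed by simp
    then have "y - ?c = bot" by (rule phi_eq_zero)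
    then show ?thesis using y(2) by (simp add: diff_eq_bot_iff)
  qed
  then have "?c \<in> maximal_elements (L_set (G_M M \<iota>) a b)" using cL unfolding maximal_elements_def by blast
  then show ?thesis by (intro bexI[of _ ?c]) simp_all
qed

lemma mv_pair_G_M: "mv_pair (G_M M \<iota>)"
  unfolding mv_pair_def
proof (intro conjI allI ballI impI)
  show "subgroup (G_M M \<iota>) Aut" by (rule subgroup_G_M)
  fix a b :: 'b and f
  assume f: "f \<in> G_M M \<iota>" and le: "a \<le> b \<and> f a \<le> b"
  \<comment> \<open>Send \<open>a\<close> to \<open>f a\<close> and \<open>b - a\<close> to
    \<open>b - f a\<close>; joining the two images gives back \<open>b\<close>.\<close>
  have "\<phi> a = \<phi> (f a)" "\<phi> (b - a) = \<phi> (b - f a)"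
    using le G_M_D(1)[OF f] phi_diff by simp_all
  moreover have "inf x (b - x) = bot" for x by (simp add: diff_eq inf_left_commute)
  ultimately obtain h where h: "h \<in> G_M M \<iota>" "h a = f a" "h (b - a) = b - f a"
    using extend_disjoint by meson
  have "sup x (b - x) = b" if "x \<le> b" for x using that by (simp add: diff_eq sup_inf_distrib1 sup.absorb2)
  then have "h b = b" using G_M_D(3)[OF h(1), of a "b - a"] h(2,3) le by simp
  then show "\<exists>h\<in>G_M M \<iota>. h a = f a \<and> h b = b" using h by blast
next
  fix a b x assume "x \<in> L_set (G_M M \<iota>) a b"
  then show "\<exists>m\<in>maximal_elements (L_set (G_M M \<iota>) a b). x \<le> m" by (rule L_set_maximal)
qed

section \<open>The quotient as a copy of \<open>M\<close>\<close>

definition fibre :: "'a \<Rightarrow> 'b set" where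
  "fibre m = {b. \<phi> b = m}"

lemma fibre_class: "orbit_rel (G_M M \<iota>) `` {b} = fibre (\<phi> b)"
  by (auto simp: orbit_rel_G_M fibre_def)

lemma bij_fibre: "bij_betw fibre C (carrier (mv_pair_algebra (G_M M \<iota>)))"
proof -
  \<comment> \<open>The element \<open>\<iota> m\<close> lies in the fibre of \<open>m\<close> and
    in no other.\<close>
  have "inj_on fibre C"
    by (rule inj_onI) (metis (mono_tags) fibre_def mem_Collect_eq phi_iota)
  moreover have "carrier (mv_pair_algebra (G_M M \<iota>)) = range (\<lambda>b. fibre (\<phi> b))"
    by (auto simp: mv_pair_algebra_def eff_quotient_def boolean_eff_alg_def quotient_def fibre_class)
  moreover have "range (\<lambda>b. fibre (\<phi> b)) = fibre ` C"
  proof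
    show "fibre ` C \<subseteq> range (\<lambda>b. fibre (\<phi> b))"
      using phi_iota by (metis (no_types, lifting) image_subsetI rangeI)
  qed (use phi_closed in auto)
  ultimately show ?thesis by (simp add: bij_betw_def)
qed

text \<open>Disjoint representatives have a join of value \<open>a \<oplus> b\<close>, so the class
  of the sum does not depend on them. Conversely, if \<open>a \<oplus> b = c\<close>, then
  \<open>\<iota> a\<close> and \<open>\<iota> c - \<iota> a\<close> are disjoint
  representatives.\<close>

lemma oplus_fibre:
  assumes a: "a \<in> C" and b: "b \<in> C"
  shows "oplus (mv_pair_algebra (G_M M \<iota>)) (fibre a) (fibre b) = map_option fibre (oplus M a b)"
proof -
  have sum: "oplus M a b = Some (\<phi> (sup x y))" if "\<phi> x = a" "\<phi> y = b" "inf x y = bot" for x y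
    using phi_additive[OF that(3)] that by simp
  show ?thesis
  proof (cases "oplus M a b")
    case None
    then show ?thesis
      using sum by (auto simp: mv_pair_algebra_def eff_quotient_def boolean_eff_alg_def eff_orth_def fibre_def)
  next
    case (Some c)
    have c: "c \<in> C" "a \<preceq> c" using oplus_closed[OF a b Some] Some b by (auto simp: eff_le_def)
    have le: "\<iota> a \<le> \<iota> c" using eff_le_iff_iota a c by blast
    have "\<phi> (\<iota> a) = a" "\<phi> (\<iota> c - \<iota> a) = b" "inf (\<iota> a) (\<iota> c - \<iota> a) = bot"
      using phi_iota[OF a] phi_iota[OF c(1)] phi_diff[OF le] ominus_eqI[OF a b Some]
      by (simp_all add: diff_eq inf_left_commute)
    then obtain x y where xy: "\<phi> x = a" "\<phi> y = b" "inf x y = bot" by blast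
    have fib: "orbit_rel (G_M M \<iota>) `` {z} = fibre c"
      if z: "oplus boolean_eff_alg x y = Some z" and x: "x \<in> fibre a" and y: "y \<in> fibre b" for x y z
    proof -
      have "inf x y = bot" "z = sup x y" using z by (auto simp: boolean_eff_alg_def split: if_splits)
      then have "\<phi> z = c" using sum[of x y] x y Some by (simp add: fibre_def)
      then show ?thesis by (simp add: fibre_class)
    qed
    have xy': "x \<in> fibre a" "y \<in> fibre b" "oplus boolean_eff_alg x y = Some (sup x y)"
      using xy by (auto simp: fibre_def boolean_eff_alg_def)
    have "(THE Z. \<exists>x\<in>fibre a. \<exists>y\<in>fibre b. \<exists>z. oplus boolean_eff_alg x y = Some z \<and>
        Z = orbit_rel (G_M M \<iota>) `` {z}) = fibre c"
    proof (rule the_equality)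
      show "\<exists>x\<in>fibre a. \<exists>y\<in>fibre b. \<exists>z. oplus boolean_eff_alg x y = Some z \<and>
          fibre c = orbit_rel (G_M M \<iota>) `` {z}"
        using xy' fib by metis
    qed (use fib in blast)
    moreover have "\<exists>x\<in>fibre a. \<exists>y\<in>fibre b. eff_orth boolean_eff_alg x y"
      using xy by (auto simp: fibre_def eff_orth_def boolean_eff_alg_def)
    ultimately show ?thesis using Some by (simp add: mv_pair_algebra_def eff_quotient_def)
  qed
qed

lemma constants_fibre:
  "ezero (mv_pair_algebra (G_M M \<iota>)) = fibre (ezero M)"
  "eone (mv_pair_algebra (G_M M \<iota>)) = fibre (eone M)"
  by (simp_all add: mv_pair_algebra_def eff_quotient_def boolean_eff_alg_def fibre_class phi_bot phi_top)

end

theorem theorem4p1: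
  fixes M :: "'a eff_alg" and \<iota> :: "'a \<Rightarrow> 'b::boolean_algebra"
  assumes "mv_effect_algebra M"
    and "R_generated (eff_order M) \<iota>"
  shows "mv_pair (G_M M \<iota>)
    \<and> mv_effect_algebra (mv_pair_algebra (G_M M \<iota>))
    \<and> eff_isomorphic (mv_pair_algebra (G_M M \<iota>)) M"
proof -
  interpret mv_boolean M \<iota>
    using assms by (intro mv_boolean.intro mv_boolean_axioms.intro)
  note transport = bij_fibre constants_fibre oplus_fibre
  show ?thesis
    using mv_pair_G_M mv_effect_algebra_transport[OF assms(1) transport]
      eff_iso_transport[OF effect_algebra_axioms transport]
    unfolding eff_isomorphic_def by blast
qed

end
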